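(* Let $N=2$ or $N=3$, and let $g=g(x')\in\mathcal{C}(\mathbb{R}^{N-1})$. Consider the problem $$-\mathrm{div}(A(x')\nabla u)=u-g(x')\ \text{ in }\mathbb{R}^N_+,\qquad u=0\ \text{ on }\partial\mathbb{R}^N_+, \qquad (P)$$ and the condition $$\forall M>0\ \ \exists\, C(M)>0:\quad 0\le u(x)\le C(M)\quad\forall x\in\mathbb{R}^{N-1}\times[0,M].\qquad (B)$$ If $g$ is not constant, then $(P)$ does not admit any solution $u\in\mathcal{C}^2(\overline{\mathbb{R}^N_+})$ satisfying $(B)$. Equivalently, if there exists $u\in\mathcal{C}^2(\overline{\mathbb{R}^N_+})$ which solves $(P)$ and satisfies $(B)$, then $g$ is constant.
   Context: $\mathbb{R}^N_+:=\mathbb{R}^{N-1}\times(0,+\infty)$, with points $x=(x',x_N)$, $x'\in\mathbb{R}^{N-1}$. Assumption on $A$: $A(x')=\begin{pmatrix}\widehat{A}(x')&0\\0&1\end{pmatrix}$ is an $N\times N$ matrix, where $\widehat{A}(x')=(a_{ij}(x'))$ is an $(N-1)\times(N-1)$ symmetric real matrix with entries $a_{ij}\in C^1(\mathbb{R}^{N-1})\cap L^\infty(\mathbb{R}^{N-1})$ and $\sum_{i,j=1}^{N-1}a_{ij}(x')\xi_i\xi_j>0$ for all $x'\in\mathbb{R}^{N-1}$, $\xi\in\mathbb{R}^{N-1}\setminus\{0\}$. *)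

theory Defs
  imports "HOL-Analysis.Analysis"
begin

definition partial :: "'a::euclidean_space \<Rightarrow> ('a \<Rightarrow> real) \<Rightarrow> 'a \<Rightarrow> real" where
  "partial e f x = frechet_derivative f (at x) e"

definition grad :: "('a::euclidean_space \<Rightarrow> real) \<Rightarrow> 'a \<Rightarrow> 'a" where
  "grad f x = (\<Sum>e\<in>Basis. partial e f x *\<^sub>R e)"

definition divergence :: "('a::euclidean_space \<Rightarrow> 'a) \<Rightarrow> 'a \<Rightarrow> real" where
  "divergence F x = (\<Sum>e\<in>Basis. partial e (\<lambda>y. F y \<bullet> e) x)"

(* For open sets: a function with continuous partial derivatives is differentiable, so demanding
   differentiability below is no restriction; it makes frechet_derivative meaningful. *)
primrec Ck_on :: "nat \<Rightarrow> 'a::euclidean_space set \<Rightarrow> ('a \<Rightarrow> real) \<Rightarrow> bool" where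
  "Ck_on 0 \<Omega> f \<longleftrightarrow> continuous_on \<Omega> f"
| "Ck_on (Suc k) \<Omega> f \<longleftrightarrow>
     (\<forall>x\<in>\<Omega>. f differentiable at x) \<and> (\<forall>e\<in>Basis. Ck_on k \<Omega> (partial e f))"

definition extends_to_closure :: "'a::euclidean_space set \<Rightarrow> ('a \<Rightarrow> real) \<Rightarrow> bool" where
  "extends_to_closure \<Omega> f \<longleftrightarrow>
     (\<exists>h. continuous_on (closure \<Omega>) h \<and> (\<forall>x\<in>\<Omega>. h x = f x))"

(* All partial derivatives of order at most k extend continuously to the closure. *)
primrec partials_extend :: "nat \<Rightarrow> 'a::euclidean_space set \<Rightarrow> ('a \<Rightarrow> real) \<Rightarrow> bool" where
  "partials_extend 0 \<Omega> f \<longleftrightarrow> extends_to_closure \<Omega> f"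
| "partials_extend (Suc k) \<Omega> f \<longleftrightarrow>
     extends_to_closure \<Omega> f \<and> (\<forall>e\<in>Basis. partials_extend k \<Omega> (partial e f))"

(* The class C^k of the closure of an open set. The first conjunct ties the boundary values
   of f itself to its values inside. *)
definition Ck_closure :: "nat \<Rightarrow> 'a::euclidean_space set \<Rightarrow> ('a \<Rightarrow> real) \<Rightarrow> bool" where
  "Ck_closure k \<Omega> f \<longleftrightarrow>
     continuous_on (closure \<Omega>) f \<and> Ck_on k \<Omega> f \<and> partials_extend k \<Omega> f"

definition L_infinity :: "('a::euclidean_space \<Rightarrow> real) \<Rightarrow> bool" where
  "L_infinity f \<longleftrightarrow>
     f \<in> borel_measurable lebesgue \<and> (\<exists>C. AE x in lebesgue. \<bar>f x\<bar> \<le> C)"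

(* R^N is rendered as (real^'n) * real with CARD('n) = N - 1; a point x = (x', x_N) is a pair. *)
definition halfspace :: "((real^'n) \<times> real) set" where
  "halfspace = UNIV \<times> {0<..}"

definition admissible_coeff :: "(real^'n \<Rightarrow> real^'n^'n) \<Rightarrow> bool" where
  "admissible_coeff a \<longleftrightarrow>
     (\<forall>x. transpose (a x) = a x) \<and>
     (\<forall>i j. Ck_on 1 UNIV (\<lambda>x. a x $ i $ j) \<and> L_infinity (\<lambda>x. a x $ i $ j)) \<and>
     (\<forall>x \<xi>. \<xi> \<noteq> 0 \<longrightarrow> (\<Sum>i\<in>UNIV. \<Sum>j\<in>UNIV. a x $ i $ j * \<xi> $ i * \<xi> $ j) > 0)"

(* Multiplication by the N x N block matrix with diagonal blocks M and 1. *)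
definition block_mult :: "real^'n^'n \<Rightarrow> (real^'n) \<times> real \<Rightarrow> (real^'n) \<times> real" where
  "block_mult M v = (M *v fst v, snd v)"

definition solves_P ::
  "(real^'n \<Rightarrow> real^'n^'n) \<Rightarrow> (real^'n \<Rightarrow> real) \<Rightarrow> ((real^'n) \<times> real \<Rightarrow> real) \<Rightarrow> bool" where
  "solves_P a g u \<longleftrightarrow>
     (\<forall>x\<in>halfspace. - divergence (\<lambda>y. block_mult (a (fst y)) (grad u y)) x = u x - g (fst x)) \<and>
     (\<forall>x\<in>frontier halfspace. u x = 0)"

definition condition_B :: "((real^'n) \<times> real \<Rightarrow> real) \<Rightarrow> bool" where
  "condition_B u \<longleftrightarrow>
     (\<forall>M>0. \<exists>C>0. \<forall>x\<in>UNIV \<times> {0..M}. 0 \<le> u x \<and> u x \<le> C)"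

end

theory Submission
  imports Defs
begin

text \<open>Write \<open>L = div (a \<nabla>)\<close> for the tangential part of the operator, so that the equation reads
  \<open>\<partial>\<^sub>N\<^sub>N u + u + L u = g\<close> with coefficients and right-hand side independent of the normal variable \<open>t\<close>. For
  a weight \<open>\<phi>\<close> on \<open>[0, 2\<pi>]\<close> the average \<open>W(x) = \<integral> \<phi>(t) u(x, t) dt\<close> satisfies, after two integrations by parts,
  an equation for \<open>L W\<close> that involves only \<open>g \<integral> \<phi>\<close>, the average of \<open>u\<close> against \<open>\<phi> + \<phi>''\<close> and the Cauchy data of \<open>u\<close>
  at both ends (\<open>elliptic_avg\<close>). Well-chosen weights turn the Liouville theorem for \<open>L\<close> into rigidity.

  That theorem (\<open>liouville\<close>) is where the dimension enters: on a space of dimension at most two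
  a bounded \<open>w\<close> with \<open>(w + c) L w \<ge> 0\<close> is constant, because balls have volume \<open>O(R\<^sup>2)\<close> and a cutoff between
  radii \<open>R\<close> and \<open>2 R\<close> costs \<open>R\<^sup>-\<^sup>2\<close>. It is applied with three families of weights.

  \<^item> \<open>\<phi> = sin\<close> gives \<open>L W = u(\<cdot>, 2\<pi>) \<ge> 0\<close>. So \<open>u\<close> vanishes at height \<open>2\<pi>\<close>, and being nonnegative it has a minimum
    there: its normal derivative vanishes as well.
  \<^item> \<open>\<phi> = cos\<close> then gives \<open>L W = \<partial>\<^sub>N u(\<cdot>, 0) \<ge> 0\<close>, so that \<open>\<partial>\<^sub>N u\<close> vanishes at height \<open>0\<close>, too.
  \<^item> \<open>\<phi> = cos (k t / 2)\<close> with \<open>k \<ge> 2\<close> now gives \<open>L W = (k\<^sup>2/4 - 1) W\<close>, so all these averages are constant.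

  Hence for two points \<open>x\<close>, \<open>z\<close> the difference \<open>u(x, t) - u(z, t)\<close> is on \<open>[0, 2\<pi>]\<close> a combination of \<open>1\<close> and \<open>cos (t/2)\<close>, by
  completeness of the cosines; it vanishes at both ends and is therefore zero
  (\<open>u_independent\<close>). With \<open>\<phi> = 1\<close> the averaged equation becomes \<open>2\<pi> g = \<integral> u dt\<close>, and the right-hand side
  does not depend on \<open>x\<close>.\<close>

section \<open>Partial derivatives, gradient and divergence\<close>

lemma partial_eq:
  assumes "(f has_derivative f') (at x)"
  shows "partial e f x = f' e"
  using frechet_derivative_at[OF assms] by (simp add: partial_def)

lemma grad_inner_Basis:
  assumes "e \<in> Basis"
  shows "grad f x \<bullet> e = partial e f x"
  using assms by (simp add: grad_def)

lemma has_derivative_grad: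
  assumes "f differentiable at x"
  shows "(f has_derivative (\<lambda>v. grad f x \<bullet> v)) (at x)"
proof -
  let ?D = "frechet_derivative f (at x)"
  have D: "(f has_derivative ?D) (at x)"
    using assms by (simp add: frechet_derivative_works)
  have "?D v = grad f x \<bullet> v" for v
  proof -
    have "?D v = ?D (\<Sum>e\<in>Basis. (v \<bullet> e) *\<^sub>R e)"
      by (simp add: euclidean_representation)
    also have "\<dots> = (\<Sum>e\<in>Basis. (v \<bullet> e) * ?D e)"
      using linear_frechet_derivative[OF assms] by (simp add: linear_sum linear_cmul)
    also have "\<dots> = grad f x \<bullet> v"
      by (simp add: grad_def partial_def inner_sum_left inner_sum_right mult.commute inner_commute)
    finally show ?thesis .
  qed
  then have "?D = (\<lambda>v. grad f x \<bullet> v)" by (rule ext)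
  then show ?thesis using D by simp
qed

lemma grad_eq:
  assumes "(f has_derivative (\<lambda>v. p \<bullet> v)) (at x)"
  shows "grad f x = p"
  by (rule euclidean_eqI) (simp add: grad_inner_Basis partial_eq[OF assms])

lemma partial_mult:
  assumes "f differentiable at x" "h differentiable at x"
  shows "partial e (\<lambda>y. f y * h y) x = f x * partial e h x + partial e f x * h x"
  using partial_eq[OF has_derivative_mult[OF has_derivative_grad[OF assms(1)]
        has_derivative_grad[OF assms(2)]], of e]
    partial_eq[OF has_derivative_grad[OF assms(1)], of e]
    partial_eq[OF has_derivative_grad[OF assms(2)], of e]
  by simp

lemma partial_sum:
  assumes "\<And>i. i \<in> I \<Longrightarrow> f i differentiable at x"
  shows "partial e (\<lambda>y. \<Sum>i\<in>I. f i y) x = (\<Sum>i\<in>I. partial e (f i) x)"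
proof -
  have "((\<lambda>y. \<Sum>i\<in>I. f i y) has_derivative (\<lambda>v. \<Sum>i\<in>I. grad (f i) x \<bullet> v)) (at x)"
    by (intro has_derivative_sum has_derivative_grad assms)
  from partial_eq[OF this] show ?thesis
    by (simp add: partial_eq[OF has_derivative_grad[OF assms]])
qed

lemma Ck_on_1_iff:
  "Ck_on 1 S f \<longleftrightarrow> (\<forall>x\<in>S. f differentiable at x) \<and> (\<forall>e\<in>Basis. continuous_on S (partial e f))"
  by simp

lemma Ck_on_1_continuous: "Ck_on 1 UNIV f \<Longrightarrow> continuous_on UNIV f"
  by (intro differentiable_imp_continuous_on differentiable_at_imp_differentiable_on)
    (simp add: Ck_on_1_iff del: Ck_on.simps One_nat_def)

lemma Ck_on_1_mult:
  assumes "Ck_on 1 UNIV f" "Ck_on 1 UNIV h"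
  shows "Ck_on 1 UNIV (\<lambda>x. f x * h x)"
proof -
  have "partial e (\<lambda>y. f y * h y) = (\<lambda>x. f x * partial e h x + partial e f x * h x)" for e
    using assms by (intro ext partial_mult) auto
  then show ?thesis
    using assms Ck_on_1_continuous[OF assms(1)] Ck_on_1_continuous[OF assms(2)]
    by (auto simp: Ck_on_1_iff simp del: Ck_on.simps One_nat_def intro!: continuous_intros differentiable_mult)
qed

lemma Ck_on_1_sum:
  assumes "finite I" and "\<And>i. i \<in> I \<Longrightarrow> Ck_on 1 UNIV (f i)"
  shows "Ck_on 1 UNIV (\<lambda>x. \<Sum>i\<in>I. f i x)"
proof -
  have "partial e (\<lambda>x. \<Sum>i\<in>I. f i x) = (\<lambda>x. \<Sum>i\<in>I. partial e (f i) x)" for e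
    using assms by (intro ext partial_sum) auto
  then show ?thesis
    using assms
    by (auto simp: Ck_on_1_iff simp del: Ck_on.simps One_nat_def intro!: continuous_intros differentiable_sum)
qed

lemma Ck_on_1_add_const:
  assumes "Ck_on 1 UNIV f"
  shows "Ck_on 1 UNIV (\<lambda>x. f x + c)" and "grad (\<lambda>x. f x + c) = grad f"
proof -
  have D: "((\<lambda>x. f x + c) has_derivative (\<lambda>v. grad f x \<bullet> v)) (at x)" for x
  proof -
    have "f differentiable at x" using assms by simp
    from has_derivative_add[OF has_derivative_grad[OF this] has_derivative_const[of c]]
    show ?thesis by simp
  qed
  then show *: "grad (\<lambda>x. f x + c) = grad f"
    by (intro ext grad_eq)
  have "partial e (\<lambda>x. f x + c) = partial e f" if "e \<in> Basis" for e
    by (rule ext) (simp add: that grad_inner_Basis[symmetric] *)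
  then show "Ck_on 1 UNIV (\<lambda>x. f x + c)"
    using assms differentiableI[OF D] by (simp add: Ck_on_1_iff del: Ck_on.simps One_nat_def)
qed

lemma divergence_scale:
  assumes "f differentiable at x" and "\<And>e. e \<in> Basis \<Longrightarrow> (\<lambda>y. G y \<bullet> e) differentiable at x"
  shows "divergence (\<lambda>y. f y *\<^sub>R G y) x = f x * divergence G x + grad f x \<bullet> G x"
proof -
  have "divergence (\<lambda>y. f y *\<^sub>R G y) x
      = (\<Sum>e\<in>Basis. f x * partial e (\<lambda>y. G y \<bullet> e) x + (grad f x \<bullet> e) * (G x \<bullet> e))"
    unfolding divergence_def
    by (intro sum.cong) (simp_all add: partial_mult assms grad_inner_Basis)
  moreover have "grad f x \<bullet> G x = (\<Sum>e\<in>Basis. (grad f x \<bullet> e) * (G x \<bullet> e))"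
    by (rule euclidean_inner)
  ultimately show ?thesis
    by (simp add: sum.distrib sum_distrib_left divergence_def)
qed

lemma continuous_on_grad:
  assumes "Ck_on 1 UNIV f"
  shows "continuous_on UNIV (grad f)"
  proof -
  have "continuous_on UNIV (\<lambda>x. \<Sum>e\<in>Basis. partial e f x *\<^sub>R e)"
  by (intro continuous_on_sum continuous_on_scaleR continuous_on_const) (use assms in simp)
  then show ?thesis by (simp add: grad_def[abs_def])
qed

section \<open>A compactly supported divergence integrates to zero\<close>

lemma integrable_continuous_compact_support:
  fixes f :: "'a::euclidean_space \<Rightarrow> real"
  assumes "continuous_on UNIV f" and "\<And>x. x \<notin> cball 0 r \<Longrightarrow> f x = 0"
  shows "integrable lborel f"
proof -
  have "integrable lborel (\<lambda>x. indicator (cball 0 r) x *\<^sub>R f x)"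
    using assms(1) by (intro borel_integrable_compact) (auto intro: continuous_on_subset)
  also have "(\<lambda>x. indicator (cball 0 r) x *\<^sub>R f x) = f"
  proof
    fix x show "indicator (cball 0 r) x *\<^sub>R f x = f x"
    using assms(2)[of x] by (cases "x \<in> cball 0 r") (simp_all del: mem_cball_0)
  qed
  finally show ?thesis .
qed

lemma partial_zero_off_support:
  assumes "\<And>x. x \<notin> cball 0 r \<Longrightarrow> f x = 0" and "x \<notin> cball 0 r"
  shows "partial e f x = 0"
proof -
  have "(f has_derivative (\<lambda>_. 0)) (at x)"
  proof (rule has_derivative_transform_within_open)
    show "((\<lambda>_. 0) has_derivative (\<lambda>_. 0)) (at x)" by (rule has_derivative_const)
    show "open (- cball 0 r)" by auto
    show "x \<in> - cball 0 r" using assms(2) by simp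
    show "\<And>y. y \<in> - cball 0 r \<Longrightarrow> 0 = f y" using assms(1) by simp
  qed
  then show ?thesis by (simp add: partial_eq)
qed

text \<open>Translation invariance of Lebesgue measure makes every difference quotient of \<open>f\<close> have
  integral zero, and dominated convergence passes this on to the derivative.\<close>

lemma integral_partial_eq_0:
  fixes f :: "'a::euclidean_space \<Rightarrow> real"
  assumes f: "Ck_on 1 UNIV f" and supp: "\<And>x. x \<notin> cball 0 r \<Longrightarrow> f x = 0" and e: "e \<in> Basis"
  shows "integrable lborel (partial e f)" and "(LINT x|lborel. partial e f x) = 0"
proof -
  have contf: "continuous_on UNIV f" by (rule Ck_on_1_continuous[OF f])
  have contp: "continuous_on UNIV (partial e f)" using f e by auto
  show "integrable lborel (partial e f)"
    by (rule integrable_continuous_compact_support[OF contp partial_zero_off_support[OF supp]])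
  have intf: "integrable lborel f"
    by (rule integrable_continuous_compact_support[OF contf supp])
  have meas: "f \<in> borel_measurable lborel" "partial e f \<in> borel_measurable lborel"
    using contf contp borel_measurable_continuous_onI by auto
  define h where "h n = inverse (real (Suc n))" for n
  have h: "h n > 0" "h n \<le> 1" for n by (auto simp: h_def field_simps)
  define q where "q n x = (f (x + h n *\<^sub>R e) - f x) / h n" for n x
  have line: "((\<lambda>s. f (x + s *\<^sub>R e)) has_real_derivative partial e f (x + s *\<^sub>R e)) (at s)" for x s
  proof -
    have "(f has_derivative (\<lambda>v. grad f (x + s *\<^sub>R e) \<bullet> v)) (at (x + s *\<^sub>R e))"
      using f by (intro has_derivative_grad) auto
    moreover have "((\<lambda>s. x + s *\<^sub>R e) has_derivative (\<lambda>t. t *\<^sub>R e)) (at s)"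
      by (auto intro!: derivative_eq_intros)
    ultimately have
      "((\<lambda>s. f (x + s *\<^sub>R e)) has_derivative (\<lambda>t. grad f (x + s *\<^sub>R e) \<bullet> (t *\<^sub>R e))) (at s)"
      by (rule has_derivative_compose[rotated])
    moreover have "(\<lambda>t. grad f (x + s *\<^sub>R e) \<bullet> (t *\<^sub>R e)) = (*) (partial e f (x + s *\<^sub>R e))"
      by (auto simp: grad_inner_Basis[OF e])
    ultimately show ?thesis by (simp add: has_field_derivative_def)
  qed
  obtain M where M: "\<And>x. x \<in> cball 0 (r + 1) \<Longrightarrow> \<bar>partial e f x\<bar> \<le> M"
  proof -
    have "bounded (partial e f ` cball 0 (r + 1))"
      by (intro compact_imp_bounded compact_continuous_image continuous_on_subset[OF contp]) auto
    then obtain a where a: "\<forall>y\<in>partial e f ` cball 0 (r + 1). norm y \<le> a"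
      unfolding bounded_iff by blast
    then show ?thesis by (intro that[of a]) auto
  qed
  have Mall: "\<bar>partial e f x\<bar> \<le> max M 0" for x
  proof (cases "x \<in> cball 0 r")
    case True
    then have "x \<in> cball 0 (r + 1)" by simp
    then show ?thesis using M[of x] by simp
  next
    case False then show ?thesis using partial_zero_off_support[OF supp False] by simp
  qed
  have bound: "norm (q n x) \<le> max M 0 * indicator (cball 0 (r + 1)) x" for n x
  proof (cases "x \<in> cball 0 (r + 1)")
    case True
    obtain z where z: "f (x + h n *\<^sub>R e) - f (x + 0 *\<^sub>R e) = (h n - 0) * partial e f (x + z *\<^sub>R e)"
      using MVT2[OF h(1)[of n], of "\<lambda>s. f (x + s *\<^sub>R e)" "\<lambda>s. partial e f (x + s *\<^sub>R e)"] line by auto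
    then have "q n x = partial e f (x + z *\<^sub>R e)" using h(1)[of n] by (simp add: q_def)
    then show ?thesis using Mall True by simp
  next
    case False
    have "norm x \<le> norm (x + h n *\<^sub>R e) + norm (h n *\<^sub>R e)"
      by (metis add_diff_cancel norm_triangle_ineq4)
    also have "norm (h n *\<^sub>R e) \<le> 1" using h[of n] e by simp
    finally have "x + h n *\<^sub>R e \<notin> cball 0 r" using False by auto
    then have "q n x = 0" using False supp[of x] supp[of "x + h n *\<^sub>R e"] by (auto simp: q_def)
    then show ?thesis by simp
  qed
  have lim: "(\<lambda>n. q n x) \<longlonglongrightarrow> partial e f x" for x
  proof -
    have "((\<lambda>s. (f (x + s *\<^sub>R e) - f x) / s) \<longlongrightarrow> partial e f x) (at 0)"
      using line[of x 0] by (simp add: has_field_derivative_iff)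
    moreover have "filterlim h (at 0) sequentially"
      using LIMSEQ_inverse_real_of_nat h(1) unfolding h_def filterlim_at
      by (auto simp: eventually_sequentially)
    ultimately show ?thesis
      unfolding q_def by (rule filterlim_compose)
  qed
  have "(\<lambda>n. LINT x|lborel. q n x) \<longlonglongrightarrow> (LINT x|lborel. partial e f x)"
  proof (rule integral_dominated_convergence)
    show "q n \<in> borel_measurable lborel" for n
      unfolding q_def using contf
      by (intro borel_measurable_divide borel_measurable_diff)
         (auto intro!: borel_measurable_continuous_onI continuous_intros continuous_on_compose2[OF contf])
    show "integrable lborel (\<lambda>x. max M 0 * indicator (cball 0 (r + 1)) x :: real)"
      by (auto intro!: integrable_mult_right integrable_real_indicator emeasure_bounded_finite)
    show "AE x in lborel. (\<lambda>n. q n x) \<longlonglongrightarrow> partial e f x" using lim by simp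
    show "AE x in lborel. norm (q n x) \<le> max M 0 * indicator (cball 0 (r + 1)) x" for n
      using bound by simp
  qed (rule meas)
  moreover have "(LINT x|lborel. q n x) = 0" for n
  proof -
    have eq: "(LINT x|lborel. f (c + x)) = (LINT x|lborel. f x)" for c
    proof -
      have "(LINT x|lborel. f x) = (LINT x|distr lborel borel ((+) c). f x)"
        by (simp add: lborel_distr_plus)
      also have "\<dots> = (LINT x|lborel. f (c + x))"
        using meas by (subst integral_distr) auto
      finally show ?thesis by simp
    qed
    have "integrable (distr lborel borel ((+) (h n *\<^sub>R e))) f"
      using intf by (simp add: lborel_distr_plus)
    then have "integrable lborel (\<lambda>x. f (h n *\<^sub>R e + x))"
      using meas by (subst (asm) integrable_distr_eq) auto
    then show ?thesis
      unfolding q_def using eq[of "h n *\<^sub>R e"] intf by (simp add: add.commute)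
  qed
  ultimately show "(LINT x|lborel. partial e f x) = 0"
    by (simp add: LIMSEQ_const_iff)
qed

lemma integral_divergence_eq_0:
  fixes F :: "'a::euclidean_space \<Rightarrow> 'a"
  assumes "\<And>e. e \<in> Basis \<Longrightarrow> Ck_on 1 UNIV (\<lambda>x. F x \<bullet> e)" and "\<And>x. x \<notin> cball 0 r \<Longrightarrow> F x = 0"
  shows "integrable lborel (divergence F)" and "(LINT x|lborel. divergence F x) = 0"
proof -
  note * = integral_partial_eq_0[OF assms(1), of _ r]
  show "integrable lborel (divergence F)"
    unfolding divergence_def using assms(2) by (intro Bochner_Integration.integrable_sum *) auto
  have "(LINT x|lborel. divergence F x) = (\<Sum>e\<in>Basis. LINT x|lborel. partial e (\<lambda>y. F y \<bullet> e) x)"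
    unfolding divergence_def using assms(2)
    by (intro Bochner_Integration.integral_sum *) auto
  then show "(LINT x|lborel. divergence F x) = 0" using * assms(2) by simp
qed

section \<open>Cutoff functions\<close>

lemma has_real_derivative_pos_part_square:
  "((\<lambda>y. (max 0 y)\<^sup>2) has_real_derivative 2 * max 0 y) (at y)" for y :: real
proof -
  consider "y < 0" | "y = 0" | "y > 0" by linarith
  then show ?thesis
  proof cases
    case 1
    have "((\<lambda>y. 0) has_real_derivative 0) (at y)" by simp
    then have "((\<lambda>y. (max 0 y)\<^sup>2) has_real_derivative 0) (at y)"
      by (rule has_field_derivative_transform_within_open[of _ _ _ "{..<0}"]) (use 1 in auto)
    then show ?thesis using 1 by simp
  next
    case 3
    have "((\<lambda>y. y\<^sup>2) has_real_derivative 2 * y) (at y)"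
      by (auto intro!: derivative_eq_intros)
    then have "((\<lambda>y. (max 0 y)\<^sup>2) has_real_derivative 2 * y) (at y)"
      by (rule has_field_derivative_transform_within_open[of _ _ _ "{0<..}"]) (use 3 in auto)
    then show ?thesis using 3 by simp
  next
    case 2
    have "((\<lambda>h. (max 0 h)\<^sup>2 / h) \<longlongrightarrow> 0) (at (0::real))"
    proof (rule Lim_null_comparison)
      show "\<forall>\<^sub>F h in at (0::real). norm ((max 0 h)\<^sup>2 / h) \<le> \<bar>h\<bar>"
        by (auto simp: max_def power2_eq_square)
      show "((\<lambda>h. \<bar>h\<bar>) \<longlongrightarrow> 0) (at (0::real))" by (auto intro!: tendsto_eq_intros)
    qed
    then show ?thesis using 2 by (simp add: has_field_derivative_iff)
  qed
qed

text \<open>The square in \<open>\<zeta> = q\<^sup>2\<close> yields the estimate \<open>\<bar>\<nabla>\<zeta>\<bar>\<^sup>2 = 4 q\<^sup>2 \<bar>\<nabla>q\<bar>\<^sup>2 \<le> C \<zeta> / R\<^sup>2\<close>, so that gradient terms can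
  be absorbed into the energy weighted by \<open>\<zeta>\<close>. A plateau on the ball of radius \<open>R\<close> with \<open>\<zeta>\<close> still
  continuously differentiable is obtained from two nested squared positive parts.\<close>

lemma cutoff_exists:
  fixes R :: real
  assumes "R > 0"
  obtains \<zeta> :: "'a::euclidean_space \<Rightarrow> real"
  where "Ck_on 1 UNIV \<zeta>" and "\<And>x. 0 \<le> \<zeta> x" and "\<And>x. \<zeta> x \<le> 1"
    and "\<And>x. norm x \<le> R \<Longrightarrow> \<zeta> x = 1 \<and> grad \<zeta> x = 0"
    and "\<And>x. norm x > 2 * R \<Longrightarrow> \<zeta> x = 0"
    and "\<And>x. (norm (grad \<zeta> x))\<^sup>2 \<le> 128 / R\<^sup>2 * \<zeta> x"
proof -
  define m where "m x = x \<bullet> x / R\<^sup>2 - 1" for x :: 'a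
  define q where "q x = max 0 (1 - (max 0 (m x))\<^sup>2)" for x
  define z where "z x = (- 8 / R\<^sup>2 * q x * max 0 (m x)) *\<^sub>R x" for x
  define \<zeta> where "\<zeta> x = (q x)\<^sup>2" for x
  have m_ge: "m x \<ge> 0 \<longleftrightarrow> norm x \<ge> R" and m_gt: "m x > 1 \<longleftrightarrow> (norm x)\<^sup>2 > 2 * R\<^sup>2" for x
  proof -
    have "m x \<ge> 0 \<longleftrightarrow> R\<^sup>2 \<le> (norm x)\<^sup>2"
      using assms by (simp add: m_def power2_norm_eq_inner field_simps)
    also have "\<dots> \<longleftrightarrow> R \<le> norm x" using assms by (simp add: abs_le_square_iff[symmetric])
    finally show "m x \<ge> 0 \<longleftrightarrow> norm x \<ge> R" .
    show "m x > 1 \<longleftrightarrow> (norm x)\<^sup>2 > 2 * R\<^sup>2"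
      using assms by (simp add: m_def power2_norm_eq_inner field_simps)
  qed
  have D: "(\<zeta> has_derivative (\<lambda>v. z x \<bullet> v)) (at x)" for x
  proof -
    have dm: "(m has_derivative (\<lambda>v. 2 * (x \<bullet> v) / R\<^sup>2)) (at x)"
      unfolding m_def using assms
      by (auto intro!: derivative_eq_intros simp: inner_commute field_simps)
    note P = has_real_derivative_pos_part_square[unfolded has_field_derivative_def]
    have "((\<lambda>x. (max 0 (m x))\<^sup>2) has_derivative (\<lambda>v. 2 * max 0 (m x) * (2 * (x \<bullet> v) / R\<^sup>2))) (at x)"
      by (rule has_derivative_compose[OF dm P])
    from has_derivative_diff[OF has_derivative_const[of 1] this]
    have "((\<lambda>x. 1 - (max 0 (m x))\<^sup>2) has_derivative
        (\<lambda>v. - (2 * max 0 (m x) * (2 * (x \<bullet> v) / R\<^sup>2)))) (at x)" by simp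
    from has_derivative_compose[OF this P]
    have "(\<zeta> has_derivative (\<lambda>v. 2 * q x * - (2 * max 0 (m x) * (2 * (x \<bullet> v) / R\<^sup>2)))) (at x)"
      by (simp add: \<zeta>_def[abs_def] q_def)
    also have "(\<lambda>v. 2 * q x * - (2 * max 0 (m x) * (2 * (x \<bullet> v) / R\<^sup>2))) = (\<lambda>v. z x \<bullet> v)"
      by (simp add: z_def algebra_simps fun_eq_iff)
    finally show ?thesis .
  qed
  have g: "grad \<zeta> x = z x" for x by (rule grad_eq[OF D])
  have contz: "continuous_on UNIV z"
    unfolding z_def[abs_def] q_def m_def by (intro continuous_intros) (use assms in auto)
  show thesis
  proof
    have "continuous_on UNIV (partial e \<zeta>)" if "e \<in> Basis" for e
    proof -
      have "partial e \<zeta> = (\<lambda>x. z x \<bullet> e)"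
        using that by (simp add: fun_eq_iff g[symmetric] grad_inner_Basis)
      then show ?thesis using contz by (auto intro!: continuous_intros)
    qed
    then show "Ck_on 1 UNIV \<zeta>"
      using differentiableI[OF D] by (simp add: Ck_on_1_iff del: Ck_on.simps One_nat_def)
    show "0 \<le> \<zeta> x" for x by (simp add: \<zeta>_def)
    have q: "0 \<le> q x" "q x \<le> 1" for x by (auto simp: q_def)
    then show "\<zeta> x \<le> 1" for x by (simp add: \<zeta>_def power_le_one)
    show "\<zeta> x = 1 \<and> grad \<zeta> x = 0" if "norm x \<le> R" for x
    proof -
      have "m x \<le> 0" using that assms
        by (simp add: m_def power2_norm_eq_inner[symmetric] field_simps power_mono)
      then show ?thesis by (simp add: \<zeta>_def q_def g z_def)
    qed
    show "\<zeta> x = 0" if "norm x > 2 * R" for x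
    proof -
      have "(2 * R)\<^sup>2 < (norm x)\<^sup>2" using that assms by (intro power_strict_mono) auto
      moreover have "2 * R\<^sup>2 \<le> (2 * R)\<^sup>2" by (simp add: power_mult_distrib)
      ultimately have "m x > 1" unfolding m_gt by (rule le_less_trans[rotated])
      then have "(max 0 (m x))\<^sup>2 > 1" by (simp add: one_less_power)
      then show ?thesis by (simp add: \<zeta>_def q_def)
    qed
    show "(norm (grad \<zeta> x))\<^sup>2 \<le> 128 / R\<^sup>2 * \<zeta> x" for x
    proof (cases "q x = 0")
      case True then show ?thesis by (simp add: g z_def \<zeta>_def)
    next
      case False
      then have "(max 0 (m x))\<^sup>2 < 1" by (auto simp: q_def)
      then have m1: "max 0 (m x) < 1" by (simp add: power_less_one_iff abs_square_less_1)
      then have n2: "(norm x)\<^sup>2 \<le> 2 * R\<^sup>2" using m_gt[of x] by auto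
      \<comment> \<open>Here \<open>\<bar>\<nabla>\<zeta>\<bar> = 8 q m\<^sup>+ \<bar>x\<bar> / R\<^sup>2\<close> with \<open>m\<^sup>+ < 1\<close> and \<open>\<bar>x\<bar>\<^sup>2 \<le> 2 R\<^sup>2\<close>, whence the constant \<open>128\<close>.\<close>
      have "(norm (z x))\<^sup>2 = (64 / R^4 * (q x)\<^sup>2) * ((max 0 (m x))\<^sup>2 * (norm x)\<^sup>2)"
        by (simp add: z_def power_mult_distrib power_divide)
      also have "\<dots> \<le> (64 / R^4 * (q x)\<^sup>2) * (1 * (2 * R\<^sup>2))"
        using n2 \<open>(max 0 (m x))\<^sup>2 < 1\<close> by (intro mult_left_mono mult_mono) auto
      also have "\<dots> = 128 / R\<^sup>2 * \<zeta> x"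
        using assms by (simp add: \<zeta>_def field_simps power_numeral_reduce)
      finally show ?thesis by (simp add: g)
    qed
  qed
qed

section \<open>The tangential operator\<close>

text \<open>The part of the operator \<open>div (A \<nabla>u)\<close> that acts on the tangential variables.\<close>

definition elliptic :: "(real^'n \<Rightarrow> real^'n^'n) \<Rightarrow> (real^'n \<Rightarrow> real) \<Rightarrow> real^'n \<Rightarrow> real" where
  "elliptic a w = divergence (\<lambda>y. a y *v grad w y)"

lemma grad_nth: "grad f x $ i = partial (axis i 1) f x" for f :: "real^'n \<Rightarrow> real"
  using grad_inner_Basis[of "axis i 1" f x] by (simp add: axis_in_Basis_iff inner_axis)

lemma Basis_vec_cases:
  assumes "e \<in> (Basis :: (real^'n) set)"
  obtains i where "e = axis i 1"
  using assms by (auto simp: Basis_vec_def)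

lemma flux_Ck_on_1:
  fixes a :: "real^'n \<Rightarrow> real^'n^'n"
  assumes "admissible_coeff a" "Ck_on 2 UNIV w" "e \<in> Basis"
  shows "Ck_on 1 UNIV (\<lambda>x. (a x *v grad w x) \<bullet> e)"
proof -
  obtain i where e: "e = axis i 1" using Basis_vec_cases[OF assms(3)] .
  have "Ck_on 1 UNIV (partial (axis j 1) w)" for j :: 'n
    using assms(2) by (simp add: numeral_2_eq_2 axis_in_Basis_iff)
  moreover have "Ck_on 1 UNIV (\<lambda>x. a x $ i $ j)" for j
    using assms(1) by (simp add: admissible_coeff_def del: Ck_on.simps)
  ultimately have "Ck_on 1 UNIV (\<lambda>x. \<Sum>j\<in>UNIV. a x $ i $ j * partial (axis j 1) w x)"
    by (intro Ck_on_1_sum Ck_on_1_mult) auto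
  then show ?thesis
    by (simp add: e inner_axis matrix_vector_mult_def grad_nth del: Ck_on.simps)
qed

lemma admissible_coeff_pos:
  fixes a :: "real^'n \<Rightarrow> real^'n^'n"
  assumes "admissible_coeff a"
  shows "z \<noteq> 0 \<Longrightarrow> z \<bullet> (a x *v z) > 0" and "z \<bullet> (a x *v z) \<ge> 0"
    and "z \<bullet> (a x *v v) = v \<bullet> (a x *v z)"
proof -
  have "z \<bullet> (a x *v z) = (\<Sum>i\<in>UNIV. \<Sum>j\<in>UNIV. a x $ i $ j * z $ i * z $ j)"
    by (simp add: inner_vec_def matrix_vector_mult_def sum_distrib_left mult_ac)
  then show *: "z \<noteq> 0 \<Longrightarrow> z \<bullet> (a x *v z) > 0"
    using assms by (simp add: admissible_coeff_def)
  show "z \<bullet> (a x *v z) \<ge> 0" using * by (cases "z = 0") auto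
  have "transpose (a x) = a x" using assms by (simp add: admissible_coeff_def)
  then show "z \<bullet> (a x *v v) = v \<bullet> (a x *v z)"
    by (metis dot_lmul_matrix inner_commute vector_transpose_matrix)
qed

lemma admissible_coeff_bounded:
  fixes a :: "real^'n \<Rightarrow> real^'n^'n"
  assumes "admissible_coeff a"
  obtains \<Lambda> where "\<Lambda> \<ge> 0" "\<And>x z. z \<bullet> (a x *v z) \<le> \<Lambda> * (norm z)\<^sup>2"
proof -
  have "\<exists>C. \<forall>x. \<bar>a x $ i $ j\<bar> \<le> C" for i j
  proof -
    obtain C where C: "AE x in lebesgue. \<bar>a x $ i $ j\<bar> \<le> C"
      using assms by (simp add: admissible_coeff_def L_infinity_def del: Ck_on.simps) blast
    have cont: "continuous_on UNIV (\<lambda>x. a x $ i $ j)"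
      using assms by (intro Ck_on_1_continuous) (simp add: admissible_coeff_def del: Ck_on.simps)
    \<comment> \<open>A continuous function obeys its almost everywhere bound at every point.\<close>
    have "closed {x. \<bar>a x $ i $ j\<bar> \<le> C}"
      by (intro closed_Collect_le continuous_intros cont)
    from mem_closed_if_AE_lebesgue[OF this] C show ?thesis by auto
  qed
  then obtain C where C: "\<And>i j x. \<bar>a x $ i $ j\<bar> \<le> C i j" by metis
  define \<Lambda> where "\<Lambda> = (\<Sum>i\<in>UNIV. \<Sum>j\<in>UNIV. C i j)"
  have C0: "C i j \<ge> 0" for i j using C[of undefined i j] by linarith
  show thesis
  proof
    show "\<Lambda> \<ge> 0" unfolding \<Lambda>_def by (intro sum_nonneg C0)
    fix x z
    have "z \<bullet> (a x *v z) = (\<Sum>i\<in>UNIV. \<Sum>j\<in>UNIV. a x $ i $ j * (z $ i * z $ j))"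
      by (simp add: inner_vec_def matrix_vector_mult_def sum_distrib_left mult_ac)
    also have "\<dots> \<le> (\<Sum>i\<in>UNIV. \<Sum>j\<in>UNIV. C i j * (norm z)\<^sup>2)"
    proof (intro sum_mono)
      fix i j
      have "\<bar>a x $ i $ j * (z $ i * z $ j)\<bar> \<le> C i j * (norm z * norm z)"
        unfolding abs_mult using C[of x i j] C0[of i j]
        by (intro mult_mono component_le_norm_cart) auto
      then show "a x $ i $ j * (z $ i * z $ j) \<le> C i j * (norm z)\<^sup>2"
        by (simp add: power2_eq_square)
    qed
    also have "\<dots> = \<Lambda> * (norm z)\<^sup>2"
      by (simp add: \<Lambda>_def sum_distrib_right)
    finally show "z \<bullet> (a x *v z) \<le> \<Lambda> * (norm z)\<^sup>2" .
  qed
qed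

section \<open>A Liouville theorem in dimension at most two\<close>

text \<open>This absorbs the cross term of the energy balance, where \<open>v\<close> is the gradient of the solution and \<open>z\<close>
  that of the cutoff. It is positivity of the quadratic form at \<open>2 s v + b z\<close>, divided by \<open>4 s\<close>.\<close>

lemma admissible_coeff_cross_term:
  fixes a :: "real^'n \<Rightarrow> real^'n^'n" and v z :: "real^'n"
  assumes "admissible_coeff a" and "s > 0"
  shows "- (b * (z \<bullet> (a x *v v))) \<le> s * (v \<bullet> (a x *v v)) + b\<^sup>2 * (z \<bullet> (a x *v z)) / (4 * s)"
proof -
  have "0 \<le> ((2 * s) *\<^sub>R v + b *\<^sub>R z) \<bullet> (a x *v ((2 * s) *\<^sub>R v + b *\<^sub>R z))"
    by (rule admissible_coeff_pos(2)[OF assms(1)])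
  also have "\<dots> = 4 * s\<^sup>2 * (v \<bullet> (a x *v v)) + 4 * s * b * (z \<bullet> (a x *v v)) + b\<^sup>2 * (z \<bullet> (a x *v z))"
    using admissible_coeff_pos(3)[OF assms(1), of v x z]
    by (simp add: matrix_vector_right_distrib matrix_vector_mult_scaleR inner_add_left
        inner_add_right power2_eq_square algebra_simps)
  also have "\<dots> = 4 * s * (s * (v \<bullet> (a x *v v)) + b * (z \<bullet> (a x *v v)) + b\<^sup>2 * (z \<bullet> (a x *v z)) / (4 * s))"
    using assms(2) by (simp add: field_simps power2_eq_square)
  finally have "0 \<le> s * (v \<bullet> (a x *v v)) + b * (z \<bullet> (a x *v v)) + b\<^sup>2 * (z \<bullet> (a x *v z)) / (4 * s)"
    using assms(2) by (simp add: zero_le_mult_iff)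
  then show ?thesis by simp
qed

text \<open>The test function is \<open>\<zeta> (w + c)\<close> for a cutoff \<open>\<zeta>\<close> between the balls of radius \<open>R\<close> and \<open>2 R\<close>;
  \<open>D\<close> is the divergence of \<open>\<zeta> (w + c) a \<nabla>w\<close>. The gradient of \<open>\<zeta>\<close> lives on the annulus
  only, so the energy inside the ball can be compared with the energy in the annulus alone.
  The last property is used with \<open>s = \<theta>\<close> in general; for \<open>\<theta> = 1\<close> the cross term is absorbed entirely by
  the weighted energy \<open>\<zeta> Q\<close> itself, so that \<open>s = 0\<close> is possible and yields an absolute bound.\<close>

lemma energy_pointwise:
  fixes a :: "real^'n \<Rightarrow> real^'n^'n" and w :: "real^'n \<Rightarrow> real"
  defines "Q \<equiv> \<lambda>x. grad w x \<bullet> (a x *v grad w x)"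
  assumes adm: "admissible_coeff a" and w: "Ck_on 2 UNIV w"
    and bnd: "\<And>x. \<bar>w x + c\<bar> \<le> B"
    and sub: "\<And>x. 0 \<le> (w x + c) * elliptic a w x"
    and \<Lambda>: "\<Lambda> \<ge> 0" "\<And>x z. z \<bullet> (a x *v z) \<le> \<Lambda> * (norm z)\<^sup>2"
    and R: "R > 0"
  obtains D where "integrable lborel D" and "(LINT x|lborel. D x) = 0"
    and "\<And>x. norm x \<le> R \<Longrightarrow> Q x \<le> D x"
    and "\<And>x. norm x > 2 * R \<Longrightarrow> D x = 0"
    and "\<And>x \<theta> s. \<lbrakk>0 < \<theta>; s = \<theta> \<or> s = 0 \<and> \<theta> = 1\<rbrakk>
          \<Longrightarrow> 0 \<le> D x + s * Q x + 32 * B\<^sup>2 * \<Lambda> / (\<theta> * R\<^sup>2)"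
proof -
  obtain \<zeta> :: "real^'n \<Rightarrow> real" where \<zeta>: "Ck_on 1 UNIV \<zeta>" "\<And>x. 0 \<le> \<zeta> x" "\<And>x. \<zeta> x \<le> 1"
    "\<And>x. norm x \<le> R \<Longrightarrow> \<zeta> x = 1 \<and> grad \<zeta> x = 0"
    "\<And>x. norm x > 2 * R \<Longrightarrow> \<zeta> x = 0"
    "\<And>x. (norm (grad \<zeta> x))\<^sup>2 \<le> 128 / R\<^sup>2 * \<zeta> x"
    using cutoff_exists[OF R] by metis
  define b where "b x = w x + c" for x
  define G where "G x = a x *v grad w x" for x
  define D where "D = divergence (\<lambda>x. (\<zeta> x * b x) *\<^sub>R G x)"
  have w1: "Ck_on 1 UNIV w"
    using w by (auto simp: numeral_2_eq_2 intro!: differentiable_imp_continuous_on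
        differentiable_at_imp_differentiable_on)
  have b1: "Ck_on 1 UNIV b" and gb: "grad b = grad w"
    unfolding b_def using Ck_on_1_add_const[OF w1, of c] by auto
  have G1: "Ck_on 1 UNIV (\<lambda>x. G x \<bullet> e)" if "e \<in> Basis" for e
    unfolding G_def by (rule flux_Ck_on_1[OF adm w that])
  have \<zeta>b: "Ck_on 1 UNIV (\<lambda>x. \<zeta> x * b x)" by (rule Ck_on_1_mult[OF \<zeta>(1) b1])
  have F1: "Ck_on 1 UNIV (\<lambda>x. ((\<zeta> x * b x) *\<^sub>R G x) \<bullet> e)" if "e \<in> Basis" for e
    using Ck_on_1_mult[OF \<zeta>b G1[OF that]] by (simp del: Ck_on.simps)
  have F0: "(\<zeta> x * b x) *\<^sub>R G x = 0" if "x \<notin> cball 0 (2 * R)" for x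
    using that \<zeta>(5)[of x] by simp
  have diff: "\<zeta> differentiable at x" "b differentiable at x" for x
    using \<zeta>(1) b1 by auto
  have D: "D x = \<zeta> x * (b x * elliptic a w x) + \<zeta> x * Q x + b x * (grad \<zeta> x \<bullet> G x)" for x
  proof -
    have "D x = (\<zeta> x * b x) * divergence G x + grad (\<lambda>x. \<zeta> x * b x) x \<bullet> G x"
      unfolding D_def using \<zeta>b G1 by (intro divergence_scale) auto
    also have "grad (\<lambda>x. \<zeta> x * b x) x = \<zeta> x *\<^sub>R grad w x + b x *\<^sub>R grad \<zeta> x"
    proof (rule grad_eq)
      show "((\<lambda>x. \<zeta> x * b x) has_derivative (\<lambda>v. (\<zeta> x *\<^sub>R grad w x + b x *\<^sub>R grad \<zeta> x) \<bullet> v)) (at x)"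
        using has_derivative_mult[OF has_derivative_grad[OF diff(1)] has_derivative_grad[OF diff(2)], of x]
        by (simp add: gb inner_add_left mult.commute)
    qed
    finally show ?thesis
      by (simp add: elliptic_def G_def[abs_def] Q_def inner_add_left algebra_simps)
  qed
  have dom: "\<zeta> x * Q x \<le> D x - b x * (grad \<zeta> x \<bullet> G x)" for x
    using mult_nonneg_nonneg[OF \<zeta>(2) sub, of x x] by (simp add: D b_def)
  have Q0: "Q x \<ge> 0" for x unfolding Q_def by (rule admissible_coeff_pos(2)[OF adm])
  show thesis
  proof
    show "integrable lborel D" "(LINT x|lborel. D x) = 0"
      unfolding D_def using integral_divergence_eq_0[OF F1 F0] by auto
    show "Q x \<le> D x" if "norm x \<le> R" for x
      using dom[of x] \<zeta>(4)[OF that] by simp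
    have zero: "D x = 0" if "\<zeta> x = 0" for x
    proof -
      have "grad \<zeta> x = 0" using \<zeta>(6)[of x] that by simp
      then show ?thesis using that by (simp add: D)
    qed
    then show "D x = 0" if "norm x > 2 * R" for x using \<zeta>(5)[OF that] by simp
    show "0 \<le> D x + s * Q x + 32 * B\<^sup>2 * \<Lambda> / (\<theta> * R\<^sup>2)"
      if \<theta>: "0 < \<theta>" and s: "s = \<theta> \<or> s = 0 \<and> \<theta> = 1" for x \<theta> s
    proof (cases "\<zeta> x = 0")
      case True
      then show ?thesis using zero[OF True] Q0[of x] \<theta> \<Lambda>(1) R s by auto
    next
      case False
      then have z: "\<zeta> x > 0" using \<zeta>(2)[of x] by simp
      have "- (b x * (grad \<zeta> x \<bullet> G x))
          \<le> (\<theta> * \<zeta> x) * Q x + (b x)\<^sup>2 * (grad \<zeta> x \<bullet> (a x *v grad \<zeta> x)) / (4 * (\<theta> * \<zeta> x))"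
        unfolding G_def Q_def by (rule admissible_coeff_cross_term[OF adm]) (use z \<theta> in simp)
      also have "(b x)\<^sup>2 * (grad \<zeta> x \<bullet> (a x *v grad \<zeta> x)) / (4 * (\<theta> * \<zeta> x))
          \<le> B\<^sup>2 * (\<Lambda> * (128 / R\<^sup>2 * \<zeta> x)) / (4 * (\<theta> * \<zeta> x))"
      proof (intro divide_right_mono mult_mono)
        show "(b x)\<^sup>2 \<le> B\<^sup>2" using bnd[of x] unfolding b_def
          by (metis abs_ge_zero power2_abs power_mono)
        show "grad \<zeta> x \<bullet> (a x *v grad \<zeta> x) \<le> \<Lambda> * (128 / R\<^sup>2 * \<zeta> x)"
          using \<Lambda>(2)[of "grad \<zeta> x" x] mult_left_mono[OF \<zeta>(6)[of x] \<Lambda>(1)] by linarith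
        show "0 \<le> grad \<zeta> x \<bullet> (a x *v grad \<zeta> x)" by (rule admissible_coeff_pos(2)[OF adm])
      qed (use z \<theta> in auto)
      also have "B\<^sup>2 * (\<Lambda> * (128 / R\<^sup>2 * \<zeta> x)) / (4 * (\<theta> * \<zeta> x)) = 32 * B\<^sup>2 * \<Lambda> / (\<theta> * R\<^sup>2)"
        using z \<theta> R by (simp add: field_simps)
      finally have "0 \<le> D x + (\<theta> - 1) * (\<zeta> x * Q x) + 32 * B\<^sup>2 * \<Lambda> / (\<theta> * R\<^sup>2)"
        using dom[of x] by (simp add: algebra_simps)
      moreover have "(\<theta> - 1) * (\<zeta> x * Q x) \<le> s * Q x"
      proof -
        have "\<theta> * (\<zeta> x * Q x) \<le> \<theta> * Q x"
          using mult_right_mono[OF \<zeta>(3)[of x] Q0[of x]] \<theta> by simp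
        moreover have "0 \<le> \<zeta> x * Q x" using z Q0[of x] by simp
        ultimately show ?thesis using s by (auto simp: algebra_simps)
      qed
      ultimately show ?thesis by linarith
    qed
  qed
qed

text \<open>In dimension at most two the volume growth \<open>R\<^sup>2\<close> of balls compensates the factor \<open>R\<^sup>-\<^sup>2\<close> from the
  cutoff. The energies \<open>E R\<close> of balls then stay bounded, hence the energies of the
  annuli tend to zero, and \<open>E R \<le> \<theta> (E (2 R) - E R) + K / \<theta>\<close> leaves nothing when first
  \<open>R\<close> and then \<open>\<theta>\<close> tends to infinity. The constant \<open>c\<close> lets the same statement cover
  bounded subsolutions (with \<open>w + c \<ge> 0\<close>) and bounded solutions of \<open>div (a \<nabla>w) = \<mu> w\<close> with \<open>\<mu> \<ge> 0\<close>
  (with \<open>c = 0\<close>).\<close>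

theorem liouville:
  fixes a :: "real^'n \<Rightarrow> real^'n^'n" and w :: "real^'n \<Rightarrow> real"
  assumes dim: "CARD('n) \<le> 2" and adm: "admissible_coeff a" and w: "Ck_on 2 UNIV w"
    and bnd: "\<And>x. \<bar>w x + c\<bar> \<le> B"
    and sub: "\<And>x. 0 \<le> (w x + c) * elliptic a w x"
  shows "grad w x = 0"
proof -
  define Q where "Q x = grad w x \<bullet> (a x *v grad w x)" for x
  have Q0: "Q x \<ge> 0" for x unfolding Q_def by (rule admissible_coeff_pos(2)[OF adm])
  have w1: "Ck_on 1 UNIV w"
    using w by (auto simp: numeral_2_eq_2 intro!: differentiable_imp_continuous_on
        differentiable_at_imp_differentiable_on)
  have contQ: "continuous_on UNIV Q"
  proof -
    have "Q = (\<lambda>x. \<Sum>e\<in>Basis. (grad w x \<bullet> e) * ((a x *v grad w x) \<bullet> e))"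
      unfolding Q_def using euclidean_inner by blast
    moreover have "continuous_on UNIV (\<lambda>x. (a x *v grad w x) \<bullet> e)" if "e \<in> Basis" for e
      by (rule Ck_on_1_continuous[OF flux_Ck_on_1[OF adm w that]])
    moreover have "continuous_on UNIV (\<lambda>x. grad w x \<bullet> e)" for e
      by (intro continuous_intros continuous_on_grad[OF w1])
    ultimately show ?thesis
      by (simp add: continuous_on_sum continuous_on_mult)
  qed
  obtain \<Lambda> where \<Lambda>: "\<Lambda> \<ge> 0" "\<And>x z. z \<bullet> (a x *v z) \<le> \<Lambda> * (norm z)\<^sup>2"
    using admissible_coeff_bounded[OF adm] by blast
  define E where "E R = (LINT x|lborel. indicator (cball 0 R) x * Q x)" for R
  have intE: "integrable lborel (\<lambda>x. indicator (cball 0 R) x * Q x)" for R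
    using borel_integrable_compact[OF compact_cball continuous_on_subset[OF contQ], of 0 R] by simp
  have int1: "integrable lborel (\<lambda>x. k * indicator (cball (0::real^'n) R) x)" for R k :: real
    by (auto intro!: integrable_mult_right integrable_real_indicator emeasure_bounded_finite)
  have Emono: "E r \<le> E R" if "r \<le> R" for r R
    unfolding E_def using that Q0
    by (intro integral_mono intE) (auto simp: indicator_def)
  define K where "K = 128 * B\<^sup>2 * \<Lambda> * unit_ball_vol CARD('n)"
  have K0: "K \<ge> 0" using \<Lambda>(1) by (simp add: K_def)
  have vol: "(32 * B\<^sup>2 * \<Lambda> / (\<theta> * R\<^sup>2)) * measure lborel (cball (0::real^'n) (2 * R)) \<le> K / \<theta>"
    if R: "R \<ge> 1" and \<theta>: "\<theta> > 0" for R \<theta>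
  proof -
    have "(2 * R) ^ CARD('n) \<le> (2 * R)\<^sup>2"
      using dim R by (intro power_increasing) auto
    then have "measure lborel (cball (0::real^'n) (2 * R)) \<le> unit_ball_vol CARD('n) * (4 * R\<^sup>2)"
      using R by (simp add: content_cball mult_left_mono power_mult_distrib)
    then have "(32 * B\<^sup>2 * \<Lambda> / (\<theta> * R\<^sup>2)) * measure lborel (cball (0::real^'n) (2 * R))
        \<le> (32 * B\<^sup>2 * \<Lambda> / (\<theta> * R\<^sup>2)) * (unit_ball_vol CARD('n) * (4 * R\<^sup>2))"
      using \<Lambda>(1) \<theta> by (intro mult_left_mono) auto
    also have "\<dots> = K / \<theta>" using R \<theta> by (simp add: K_def field_simps)
    finally show ?thesis .
  qed
  have key: "E R \<le> s * (E (2 * R) - E R) + K / \<theta>"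
    if R: "R \<ge> 1" and \<theta>: "\<theta> > 0" and s: "s = \<theta> \<or> s = 0 \<and> \<theta> = 1" for R \<theta> s
  proof -
    have R0: "R > 0" using R by simp
    obtain D where D: "integrable lborel D" "(LINT x|lborel. D x) = 0"
      "\<And>x. norm x \<le> R \<Longrightarrow> Q x \<le> D x" "\<And>x. norm x > 2 * R \<Longrightarrow> D x = 0"
      "\<And>x \<theta> s. \<lbrakk>0 < \<theta>; s = \<theta> \<or> s = 0 \<and> \<theta> = 1\<rbrakk>
        \<Longrightarrow> 0 \<le> D x + s * Q x + 32 * B\<^sup>2 * \<Lambda> / (\<theta> * R\<^sup>2)"
      by (rule energy_pointwise[OF adm w bnd sub \<Lambda> R0, folded Q_def]) (blast intro: that)
    define M where "M = 32 * B\<^sup>2 * \<Lambda> / (\<theta> * R\<^sup>2)"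
    have M0: "M \<ge> 0" using \<Lambda>(1) \<theta> by (simp add: M_def)
    let ?I = "\<lambda>r x. indicator (cball (0::real^'n) r) x :: real"
    have "E R \<le> (LINT x|lborel. D x + s * (?I (2 * R) x * Q x - ?I R x * Q x) + M * ?I (2 * R) x)"
      unfolding E_def
    proof (intro integral_mono intE Bochner_Integration.integrable_add D(1) integrable_mult_right
        Bochner_Integration.integrable_diff)
      fix x :: "real^'n"
      consider "norm x \<le> R" | "norm x > R" "norm x \<le> 2 * R" | "norm x > 2 * R" by linarith
      then show "?I R x * Q x \<le> D x + s * (?I (2 * R) x * Q x - ?I R x * Q x) + M * ?I (2 * R) x"
      proof cases
        case 1 then show ?thesis using R D(3)[of x] M0 by simp
      next
        case 2 then show ?thesis using D(5)[OF \<theta> s, of x] by (simp add: M_def)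
      next
        case 3 then show ?thesis using D(4)[of x] R by simp
      qed
    qed (use int1[of 1] in simp_all)
    also have "\<dots> = s * (E (2 * R) - E R) + M * measure lborel (cball (0::real^'n) (2 * R))"
    proof -
      have "?I (2 * R) = indicator (cball 0 (2 * R))" ..
      then show ?thesis
        using D(1,2) intE int1[of 1] by (simp add: E_def)
    qed
    also have "M * measure lborel (cball (0::real^'n) (2 * R)) \<le> K / \<theta>"
      unfolding M_def by (rule vol[OF R \<theta>])
    finally show ?thesis by simp
  qed
  have bounded: "E R \<le> K" if R: "R \<ge> 1" for R
    using key[OF R, of 1 0] by simp
  have "E R = 0" if R: "R \<ge> 1" for R
  proof -
    have "E R \<le> K / \<theta>" if \<theta>: "\<theta> > 0" for \<theta>
    proof -
      define X where "X n = E (2 ^ n * R)" for n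
      have ge1: "2 ^ n * R \<ge> 1" for n using R by (metis mult_mono' mult_1 one_le_power zero_le_one one_le_numeral)
      have "incseq X"
        unfolding X_def using R by (intro incseq_SucI Emono) auto
      moreover have "X n \<le> K" for n unfolding X_def by (rule bounded[OF ge1])
      ultimately obtain l where l: "X \<longlonglongrightarrow> l" using incseq_convergent by metis
      have "(\<lambda>n. \<theta> * (X (Suc n) - X n) + K / \<theta>) \<longlonglongrightarrow> \<theta> * (l - l) + K / \<theta>"
        by (intro tendsto_intros l LIMSEQ_Suc)
      moreover have "E R \<le> \<theta> * (X (Suc n) - X n) + K / \<theta>" for n
      proof -
        have "E R \<le> X n" unfolding X_def using R by (intro Emono) simp
        also have "\<dots> \<le> \<theta> * (X (Suc n) - X n) + K / \<theta>"
          using key[OF ge1 \<theta>, of \<theta> n] by (simp add: X_def mult.assoc)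
        finally show ?thesis .
      qed
      ultimately have "E R \<le> \<theta> * (l - l) + K / \<theta>"
        by (intro LIMSEQ_le_const) auto
      then show ?thesis by simp
    qed
    moreover have "((\<lambda>\<theta>. K / \<theta>) \<longlongrightarrow> 0) at_top"
      by (intro tendsto_divide_0[OF tendsto_const] filterlim_at_top_imp_at_infinity filterlim_ident)
    ultimately have "E R \<le> 0"
      by (intro tendsto_lowerbound[of "\<lambda>\<theta>. K / \<theta>" 0 at_top]) (auto intro: eventually_mono[OF eventually_gt_at_top[of 0]])
    moreover have "E R \<ge> 0" unfolding E_def using Q0 by (intro integral_nonneg_AE) auto
    ultimately show ?thesis by simp
  qed
  then have E0: "E (norm x + 1) = 0" by simp
  have "AE y in lborel. indicator (cball 0 (norm x + 1)) y * Q y = 0"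
    using E0 integral_nonneg_eq_0_iff_AE[OF intE] Q0 unfolding E_def by simp
  then have "AE y in lebesgue. indicator (cball 0 (norm x + 1)) y * Q y = 0"
    by (rule AE_completion)
  then have "AE y \<in> ball 0 (norm x + 1) in lebesgue. y \<in> {y. Q y = 0}"
    by (rule eventually_mono) (simp split: split_indicator_asm)
  moreover have "closed {y. Q y = 0}"
    by (rule closed_Collect_eq[OF contQ continuous_on_const])
  moreover have "x \<in> ball 0 (norm x + 1)" by simp
  ultimately have "x \<in> {y. Q y = 0}"
    using mem_closed_if_AE_lebesgue_open[OF open_ball] by blast
  then have "grad w x \<bullet> (a x *v grad w x) = 0" by (simp add: Q_def)
  then show ?thesis using admissible_coeff_pos(1)[OF adm, of "grad w x" x] by force
qed

section \<open>Cosines on an interval\<close>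

lemma integral_cos_half:
  assumes "n \<ge> 1"
  shows "integral {0..2 * pi} (\<lambda>t. cos (real n * t / 2)) = 0"
proof -
  have "((\<lambda>t. cos (real n * t / 2)) has_integral
      (2 / real n * sin (real n * (2 * pi) / 2) - 2 / real n * sin (real n * 0 / 2))) {0..2 * pi}"
    by (rule fundamental_theorem_of_calculus)
      (use assms in \<open>auto intro!: derivative_eq_intros
        simp: has_real_derivative_iff_has_vector_derivative[symmetric]\<close>)
  moreover have "sin (real n * (2 * pi) / 2) = 0" by simp
  ultimately show ?thesis by (simp add: integral_unique)
qed

lemma integral_cos_half_mult:
  assumes "m < k"
  shows "integral {0..2 * pi} (\<lambda>t. cos (real m * t / 2) * cos (real k * t / 2)) = 0"
proof -
  have eq: "cos (real m * t / 2) * cos (real k * t / 2)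
      = (1 / 2) * (cos (real (k - m) * t / 2) + cos (real (k + m) * t / 2))" for t
  proof -
    have "real k * t / 2 - real m * t / 2 = real (k - m) * t / 2"
      "real k * t / 2 + real m * t / 2 = real (k + m) * t / 2"
      using assms by (simp_all add: of_nat_diff field_simps)
    then show ?thesis
      using cos_times_cos[of "real k * t / 2" "real m * t / 2"]
      by (simp only: mult.commute[of "cos (real m * t / 2)"])
  qed
  have int: "(\<lambda>t. cos (real n * t / 2)) integrable_on {0..2 * pi}" for n
    by (intro integrable_continuous_interval continuous_intros) auto
  show ?thesis
    unfolding eq integral_mult_right
    by (subst Henstock_Kurzweil_Integration.integral_add[OF int int])
      (use assms integral_cos_half[of "k - m"] integral_cos_half[of "k + m"] in simp)
qed

text \<open>The moments \<open>\<integral> h cos\<^sup>n (t/2)\<close> vanish because \<open>cos (t/2) cos (kt/2)\<close> is a mean of two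
  neighbouring cosines; polynomials in \<open>cos (t/2)\<close> are dense by Weierstrass.\<close>

lemma zero_if_cosine_coefficients_zero:
  fixes h :: "real \<Rightarrow> real"
  assumes cont: "continuous_on {0..2 * pi} h"
    and coeff: "\<And>k. integral {0..2 * pi} (\<lambda>t. h t * cos (real k * t / 2)) = 0"
    and t: "t \<in> {0..2 * pi}"
  shows "h t = 0"
proof -
  let ?I = "integral {0..2 * pi}"
  have int: "f integrable_on {0..2 * pi}" if "continuous_on {0..2 * pi} f" for f :: "real \<Rightarrow> real"
    using that by (rule integrable_continuous_interval)
  have pow: "?I (\<lambda>t. h t * cos (t / 2) ^ n * cos (real k * t / 2)) = 0" for n k
  proof (induction n arbitrary: k)
    case 0 then show ?case using coeff[of k] by simp
  next
    case (Suc n)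
    show ?case
    proof (cases k)
      case 0
      then show ?thesis using Suc[of 1] by (simp add: mult_ac)
    next
      case (Suc m)
      have "cos (t / 2) * cos (real k * t / 2)
          = (cos (real m * t / 2) + cos (real (Suc k) * t / 2)) / 2" for t
      proof -
        have "real k * t / 2 - t / 2 = real m * t / 2" "real k * t / 2 + t / 2 = real (Suc k) * t / 2"
          by (simp_all add: Suc field_simps)
        then show ?thesis
          using cos_times_cos[of "real k * t / 2" "t / 2"]
          by (simp only: mult.commute[of "cos (t / 2)"])
      qed
      then have "h t * cos (t / 2) ^ n * (cos (t / 2) * cos (real k * t / 2))
          = (1 / 2) * (h t * cos (t / 2) ^ n * cos (real m * t / 2)
            + h t * cos (t / 2) ^ n * cos (real (Suc k) * t / 2))" for t
        by (simp only: distrib_left) (simp add: field_simps)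
      then have "h t * cos (t / 2) ^ Suc n * cos (real k * t / 2)
          = (1 / 2) * (h t * cos (t / 2) ^ n * cos (real m * t / 2)
            + h t * cos (t / 2) ^ n * cos (real (Suc k) * t / 2))" for t
        by (simp only: power_Suc mult_ac)
      then have "?I (\<lambda>t. h t * cos (t / 2) ^ Suc n * cos (real k * t / 2))
          = (1 / 2) * (?I (\<lambda>t. h t * cos (t / 2) ^ n * cos (real m * t / 2)
            + h t * cos (t / 2) ^ n * cos (real (Suc k) * t / 2)))"
        by (simp only: integral_mult_right)
      also have "?I (\<lambda>t. h t * cos (t / 2) ^ n * cos (real m * t / 2)
            + h t * cos (t / 2) ^ n * cos (real (Suc k) * t / 2)) = 0"
      proof -
        have i: "(\<lambda>t. h t * cos (t / 2) ^ n * cos (real l * t / 2)) integrable_on {0..2 * pi}" for l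
          by (intro int continuous_intros cont) auto
        then show ?thesis
          using Henstock_Kurzweil_Integration.integral_add[OF i[of m] i[of "Suc k"]]
          by (simp only: Suc.IH add_0)
      qed
      finally show ?thesis by simp
    qed
  qed
  have small: "?I (\<lambda>t. h t * h t) \<le> e * ?I (\<lambda>t. \<bar>h t\<bar>)" if "e > 0" for e
  proof -
    have "continuous_on {-1..1} (\<lambda>y. h (2 * arccos y))"
    proof (rule continuous_on_compose2[OF cont])
      show "continuous_on {-1..1} (\<lambda>y. 2 * arccos y)" by (intro continuous_intros continuous_on_arccos')
      show "(\<lambda>y. 2 * arccos y) ` {-1..1} \<subseteq> {0..2 * pi}"
        using arccos_lbound arccos_ubound by auto
    qed
    from Stone_Weierstrass_real_polynomial_function[OF compact_Icc this \<open>e > 0\<close>]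
    obtain f where f: "real_polynomial_function f"
      "\<And>y. y \<in> {-1..1} \<Longrightarrow> \<bar>h (2 * arccos y) - f y\<bar> < e" by metis
    from f(1) obtain b n where fe: "f = (\<lambda>y. \<Sum>i\<le>n. b i * y ^ i)"
      using real_polynomial_function_iff_sum by blast
    have contf: "continuous_on {0..2 * pi} (\<lambda>t. f (cos (t / 2)))"
      unfolding fe by (intro continuous_intros) auto
    have "?I (\<lambda>t. h t * f (cos (t / 2))) = (\<Sum>i\<le>n. b i * ?I (\<lambda>t. h t * cos (t / 2) ^ i * cos (real 0 * t / 2)))"
    proof -
      have "?I (\<lambda>t. h t * f (cos (t / 2))) = ?I (\<lambda>t. \<Sum>i\<le>n. b i * (h t * cos (t / 2) ^ i))"
        by (simp add: fe sum_distrib_left mult_ac)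
      also have "\<dots> = (\<Sum>i\<le>n. ?I (\<lambda>t. b i * (h t * cos (t / 2) ^ i)))"
        by (intro Henstock_Kurzweil_Integration.integral_sum int continuous_intros cont) auto
      finally show ?thesis by simp
    qed
    then have orth: "?I (\<lambda>t. h t * f (cos (t / 2))) = 0" by (simp only: pow) simp
    have "?I (\<lambda>t. h t * h t) = ?I (\<lambda>t. h t * h t) - ?I (\<lambda>t. h t * f (cos (t / 2)))"
      by (simp add: orth)
    also have "\<dots> = ?I (\<lambda>t. h t * h t - h t * f (cos (t / 2)))"
      by (intro Henstock_Kurzweil_Integration.integral_diff[symmetric] int continuous_intros cont contf)
    also have "\<dots> \<le> ?I (\<lambda>t. e * \<bar>h t\<bar>)"
    proof (intro integral_le int continuous_intros cont contf)
      fix t assume "t \<in> {0..2 * pi}"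
      then have "\<bar>h t - f (cos (t / 2))\<bar> < e"
        using f(2)[of "cos (t / 2)"] by (simp add: arccos_cos)
      then have "\<bar>h t * (h t - f (cos (t / 2)))\<bar> \<le> \<bar>h t\<bar> * e"
        unfolding abs_mult by (intro mult_left_mono) auto
      then show "h t * h t - h t * f (cos (t / 2)) \<le> e * \<bar>h t\<bar>"
        by (simp add: right_diff_distrib mult.commute)
    qed
    finally show ?thesis by simp
  qed
  have "((\<lambda>e. e * ?I (\<lambda>t. \<bar>h t\<bar>)) \<longlongrightarrow> 0 * ?I (\<lambda>t. \<bar>h t\<bar>)) (at_right 0)"
    by (intro tendsto_intros)
  then have "?I (\<lambda>t. h t * h t) \<le> 0 * ?I (\<lambda>t. \<bar>h t\<bar>)"
    by (rule tendsto_lowerbound) (auto intro!: eventually_at_rightI[of 0 1] small)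
  moreover have "?I (\<lambda>t. h t * h t) \<ge> 0"
    by (intro integral_nonneg int continuous_intros cont) auto
  ultimately have "?I (\<lambda>t. h t * h t) = 0" by simp
  moreover have "(?I (\<lambda>t. h t * h t) = 0) = (\<forall>t\<in>{0..2 * pi}. h t * h t = 0)"
    by (intro integral_eq_0_iff continuous_intros cont) auto
  ultimately show ?thesis using t by simp
qed

text \<open>The two missing coefficients are recovered from the two boundary values: \<open>1\<close> and \<open>cos (t/2)\<close> are
  linearly independent on \<open>{0, 2\<pi>}\<close>.\<close>

lemma zero_if_higher_cosine_coefficients_zero:
  fixes d :: "real \<Rightarrow> real"
  assumes cont: "continuous_on {0..2 * pi} d"
    and coeff: "\<And>k. k \<ge> 2 \<Longrightarrow> integral {0..2 * pi} (\<lambda>t. d t * cos (real k * t / 2)) = 0"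
    and bc: "d 0 = 0" "d (2 * pi) = 0" and t: "t \<in> {0..2 * pi}"
  shows "d t = 0"
proof -
  let ?I = "integral {0..2 * pi}"
  define \<alpha> where "\<alpha> = ?I d / (2 * pi)"
  define \<beta> where "\<beta> = ?I (\<lambda>t. d t * cos (t / 2)) / pi"
  define h where "h t = d t - \<alpha> - \<beta> * cos (t / 2)" for t
  have conth: "continuous_on {0..2 * pi} h"
    unfolding h_def by (intro continuous_intros cont) auto
  have int: "f integrable_on {0..2 * pi}" if "continuous_on {0..2 * pi} f" for f :: "real \<Rightarrow> real"
    using that by (rule integrable_continuous_interval)
  have "?I (\<lambda>t. h t * cos (real k * t / 2)) = 0" for k
  proof -
    let ?c = "\<lambda>t. cos (real k * t / 2)"
    have i: "(\<lambda>t. d t * ?c t) integrable_on {0..2 * pi}" "(\<lambda>t. \<alpha> * ?c t) integrable_on {0..2 * pi}"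
      "(\<lambda>t. \<beta> * (cos (real 1 * t / 2) * ?c t)) integrable_on {0..2 * pi}"
      by (intro int continuous_intros cont; simp)+
    have "?I (\<lambda>t. h t * ?c t) = ?I (\<lambda>t. d t * ?c t - \<alpha> * ?c t - \<beta> * (cos (real 1 * t / 2) * ?c t))"
      by (simp add: h_def algebra_simps)
    also have "\<dots> = ?I (\<lambda>t. d t * ?c t) - \<alpha> * ?I ?c - \<beta> * ?I (\<lambda>t. cos (real 1 * t / 2) * ?c t)"
      using i by (simp add: Henstock_Kurzweil_Integration.integral_diff
          Henstock_Kurzweil_Integration.integrable_diff del: of_nat_1)
    also have "\<dots> = 0"
    proof -
      consider "k = 0" | "k = 1" | "k \<ge> 2" by linarith
      then show ?thesis
      proof cases
        case 1 then show ?thesis using integral_cos_half[of 1] by (simp add: \<alpha>_def)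
      next
        case 2
        have "cos (t / 2) * cos (t / 2) = (1 / 2) * (1 + cos (real 2 * t / 2))" for t
          using cos_double_cos[of "t / 2"] by (simp add: power2_eq_square)
        then have "?I (\<lambda>t. cos (t / 2) * cos (t / 2)) = (1 / 2) * ?I (\<lambda>t. 1 + cos (real 2 * t / 2))"
          by (simp only: integral_mult_right)
        also have "?I (\<lambda>t. 1 + cos (real 2 * t / 2)) = 2 * pi + ?I (\<lambda>t. cos (real 2 * t / 2))"
          by (subst Henstock_Kurzweil_Integration.integral_add) (auto intro!: int continuous_intros)
        also have "?I (\<lambda>t. cos (real 2 * t / 2)) = 0" by (rule integral_cos_half) simp
        finally show ?thesis using 2 integral_cos_half[of 1] by (simp add: \<beta>_def)
      next
        case 3
        then show ?thesis
          using coeff[of k] integral_cos_half[of k] integral_cos_half_mult[of 1 k] by simp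
      qed
    qed
    finally show ?thesis .
  qed
  then have h0: "h s = 0" if "s \<in> {0..2 * pi}" for s
    using zero_if_cosine_coefficients_zero[OF conth] that by blast
  have "\<alpha> + \<beta> = 0" using h0[of 0] bc(1) by (simp add: h_def)
  moreover have "\<alpha> - \<beta> = 0" using h0[of "2 * pi"] bc(2) by (simp add: h_def)
  ultimately show ?thesis using h0[OF t] by (simp add: h_def)
qed

section \<open>Averages in the normal direction\<close>

lemma sum_Basis_vec: "(\<Sum>e\<in>Basis. f e) = (\<Sum>i\<in>UNIV. f (axis i 1 :: real^'n))"
  unfolding Basis_vec_def by (subst sum.UNION_disjoint) (auto simp: axis_eq_axis)

lemma elliptic_expand:
  fixes a :: "real^'n \<Rightarrow> real^'n^'n"
  assumes "admissible_coeff a" "Ck_on 2 UNIV w"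
  shows "elliptic a w x = (\<Sum>i\<in>UNIV. \<Sum>j\<in>UNIV.
      partial (axis i 1) (\<lambda>x. a x $ i $ j) x * partial (axis j 1) w x
      + a x $ i $ j * partial (axis i 1) (partial (axis j 1) w) x)"
proof -
  have da: "(\<lambda>x. a x $ i $ j) differentiable at x" for i j
    using assms(1) by (simp add: admissible_coeff_def)
  have dw: "partial (axis j 1) w differentiable at x" for j
    using assms(2) by (simp add: numeral_2_eq_2 axis_in_Basis_iff)
  have "elliptic a w x = (\<Sum>i\<in>UNIV. partial (axis i 1) (\<lambda>y. (a y *v grad w y) \<bullet> axis i 1) x)"
    by (simp add: elliptic_def divergence_def sum_Basis_vec)
  also have "\<dots> = (\<Sum>i\<in>UNIV. partial (axis i 1) (\<lambda>y. \<Sum>j\<in>UNIV. a y $ i $ j * partial (axis j 1) w y) x)"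
    by (simp add: inner_axis matrix_vector_mult_def grad_nth)
  also have "\<dots> = (\<Sum>i\<in>UNIV. \<Sum>j\<in>UNIV. partial (axis i 1) (\<lambda>y. a y $ i $ j * partial (axis j 1) w y) x)"
    by (intro sum.cong refl partial_sum differentiable_mult da dw)
  finally show ?thesis by (simp add: partial_mult[OF da dw] add.commute)
qed

lemma grad_prod:
  fixes f :: "(real^'n) \<times> real \<Rightarrow> real"
  shows "fst (grad f y) $ i = partial (axis i 1, 0) f y" and "snd (grad f y) = partial (0, 1) f y"
proof -
  have "fst (grad f y) $ i = grad f y \<bullet> (axis i 1, 0)"
    by (simp add: inner_prod_def inner_axis)
  also have "\<dots> = partial (axis i 1, 0) f y"
    by (rule grad_inner_Basis) (simp add: Basis_prod_def axis_in_Basis_iff)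
  finally show "fst (grad f y) $ i = partial (axis i 1, 0) f y" .
  have "snd (grad f y) = grad f y \<bullet> (0, 1)" by (simp add: inner_prod_def)
  also have "\<dots> = partial (0, 1) f y" by (rule grad_inner_Basis) (simp add: Basis_prod_def)
  finally show "snd (grad f y) = partial (0, 1) f y" .
qed

lemma has_derivative_tangential:
  fixes f :: "(real^'n) \<times> real \<Rightarrow> real"
  assumes "f differentiable at (x, t)"
  shows "((\<lambda>y. f (y, t)) has_derivative (\<lambda>v. (\<chi> i. partial (axis i 1, 0) f (x, t)) \<bullet> v)) (at x)"
proof -
  have "((\<lambda>y. f (y, t)) has_derivative (\<lambda>v. grad f (x, t) \<bullet> (v, 0))) (at x)"
  proof (rule has_derivative_compose[of "\<lambda>y. (y, t)"])
    show "((\<lambda>y. (y, t)) has_derivative (\<lambda>v. (v, 0))) (at x)" by (auto intro!: derivative_eq_intros)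
  qed (rule has_derivative_grad[OF assms])
  moreover have "(\<chi> i. partial (axis i 1, 0) f (x, t)) = fst (grad f (x, t))"
    by (simp add: vec_eq_iff grad_prod)
  ultimately show ?thesis by (simp add: inner_prod_def)
qed

lemma has_derivative_normal:
  fixes f :: "(real^'n) \<times> real \<Rightarrow> real"
  assumes "f differentiable at (x, t)"
  shows "((\<lambda>s. f (x, s)) has_real_derivative partial (0, 1) f (x, t)) (at t)"
proof -
  have "((\<lambda>s. f (x, s)) has_derivative (\<lambda>s. grad f (x, t) \<bullet> (0, s))) (at t)"
  proof (rule has_derivative_compose[of "\<lambda>s. (x, s)"])
    show "((\<lambda>s. (x, s)) has_derivative (\<lambda>s. (0, s))) (at t)" by (auto intro!: derivative_eq_intros)
  qed (rule has_derivative_grad[OF assms])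
  moreover have "(\<lambda>s. grad f (x, t) \<bullet> (0, s)) = (*) (partial (0, 1) f (x, t))"
    by (simp add: inner_prod_def grad_prod fun_eq_iff)
  ultimately show ?thesis by (simp add: has_field_derivative_def)
qed

text \<open>Differentiability in the tangential variables is known only for \<open>t > 0\<close>. It passes to the
  boundary because the gradients converge locally uniformly as \<open>t\<close> decreases to \<open>0\<close>.\<close>

lemma has_derivative_boundary:
  fixes F :: "'a::euclidean_space \<times> real \<Rightarrow> real" and G :: "'a \<times> real \<Rightarrow> 'a"
  assumes F: "continuous_on (UNIV \<times> {0..}) F" and G: "continuous_on (UNIV \<times> {0..}) G"
    and D: "\<And>x t. t > 0 \<Longrightarrow> ((\<lambda>y. F (y, t)) has_derivative (\<lambda>v. G (x, t) \<bullet> v)) (at x)"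
    and t: "t \<ge> 0"
  shows "((\<lambda>y. F (y, t)) has_derivative (\<lambda>v. G (x, t) \<bullet> v)) (at x)"
proof (cases "t = 0")
  case False then show ?thesis using D t by simp
next
  case True
  define h where "h n = inverse (real (Suc n))" for n
  have h: "h n > 0" "h n \<le> 1" for n by (auto simp: h_def field_simps)
  have h0: "h \<longlonglongrightarrow> 0" unfolding h_def by (rule LIMSEQ_inverse_real_of_nat)
  have lim: "(\<lambda>n. F (y, h n)) \<longlonglongrightarrow> F (y, 0)" for y
    by (rule continuous_on_tendsto_compose[OF F]) (use h(1)[THEN less_imp_le] h0 in \<open>auto intro!: tendsto_intros\<close>)
  let ?K = "cball x 1 \<times> {0..1::real}"
  have "uniformly_continuous_on ?K G"
    by (intro compact_uniformly_continuous compact_Times continuous_on_subset[OF G]) auto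
  then have uc: "\<exists>d>0. \<forall>p\<in>?K. \<forall>q\<in>?K. dist q p < d \<longrightarrow> dist (G q) (G p) < e" if "e > 0" for e
    using that unfolding uniformly_continuous_on_def by blast
  have "\<exists>k. \<forall>y\<in>ball x 1. (\<lambda>n. F (y, h n)) \<longlonglongrightarrow> k y
      \<and> (k has_derivative (\<lambda>v. G (y, 0) \<bullet> v)) (at y within ball x 1)"
  proof (rule has_derivative_sequence[OF convex_ball, where f' = "\<lambda>n y v. G (y, h n) \<bullet> v"])
    show "((\<lambda>y. F (y, h n)) has_derivative (\<lambda>v. G (y, h n) \<bullet> v)) (at y within ball x 1)" for n y
      by (rule has_derivative_at_withinI[OF D[OF h(1)]])
    fix e :: real assume "e > 0"
    then obtain d where d: "d > 0" "\<And>p q. \<lbrakk>p \<in> ?K; q \<in> ?K; dist q p < d\<rbrakk> \<Longrightarrow> dist (G q) (G p) < e"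
      using uc by metis
    have "\<forall>\<^sub>F n in sequentially. h n < d" using h0 d(1) by (rule order_tendstoD)
    then show "\<forall>\<^sub>F n in sequentially. \<forall>y\<in>ball x 1. \<forall>v. norm (G (y, h n) \<bullet> v - G (y, 0) \<bullet> v) \<le> e * norm v"
    proof (rule eventually_mono, intro ballI allI)
      fix n and y v :: 'a assume n: "h n < d" and y: "y \<in> ball x 1"
      have "dist (G (y, h n)) (G (y, 0)) < e"
        by (rule d(2)) (use y n h[of n] in \<open>auto simp: dist_prod_def less_imp_le\<close>)
      then have "norm (G (y, h n) - G (y, 0)) \<le> e" by (simp add: dist_norm)
      then have "norm (G (y, h n) - G (y, 0)) * norm v \<le> e * norm v" by (intro mult_right_mono) auto
      then show "norm (G (y, h n) \<bullet> v - G (y, 0) \<bullet> v) \<le> e * norm v"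
        using Cauchy_Schwarz_ineq2[of "G (y, h n) - G (y, 0)" v] by (simp add: inner_diff_left)
    qed
  next
    show "x \<in> ball x 1" by simp
    show "(\<lambda>n. F (x, h n)) \<longlonglongrightarrow> F (x, 0)" by (rule lim)
  qed
  then obtain k where k: "\<And>y. y \<in> ball x 1 \<Longrightarrow> (\<lambda>n. F (y, h n)) \<longlonglongrightarrow> k y"
    "\<And>y. y \<in> ball x 1 \<Longrightarrow> (k has_derivative (\<lambda>v. G (y, 0) \<bullet> v)) (at y within ball x 1)" by blast
  have eq: "k y = F (y, 0)" if "y \<in> ball x 1" for y
    using LIMSEQ_unique[OF k(1)[OF that] lim] .
  have "(k has_derivative (\<lambda>v. G (x, 0) \<bullet> v)) (at x)"
    using k(2)[of x] at_within_open[of x "ball x 1"] by simp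
  then have "((\<lambda>y. F (y, 0)) has_derivative (\<lambda>v. G (x, 0) \<bullet> v)) (at x)"
    by (rule has_derivative_transform_within_open[OF _ open_ball centre_in_ball[THEN iffD2, of 1]])
      (simp_all only: eq zero_less_one)
  then show ?thesis using True by simp
qed

lemma average_continuous:
  fixes F :: "'a::euclidean_space \<times> real \<Rightarrow> real"
  assumes F: "continuous_on (UNIV \<times> {0..}) F" and \<phi>: "continuous_on {0..T} \<phi>"
  shows "continuous_on UNIV (\<lambda>x. integral {0..T} (\<lambda>t. \<phi> t * F (x, t)))"
proof -
  have "continuous_on (UNIV \<times> cbox 0 T) (\<lambda>(x, t). \<phi> t * F (x, t))"
    unfolding split_beta
    by (intro continuous_intros continuous_on_compose2[OF F] continuous_on_compose2[OF \<phi>]) auto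
  from integral_continuous_on_param[OF this] show ?thesis by simp
qed

lemma average_has_derivative:
  fixes F :: "'a::euclidean_space \<times> real \<Rightarrow> real" and G :: "'a \<times> real \<Rightarrow> 'a"
  assumes F: "continuous_on (UNIV \<times> {0..}) F" and G: "continuous_on (UNIV \<times> {0..}) G"
    and D: "\<And>x t. t > 0 \<Longrightarrow> ((\<lambda>y. F (y, t)) has_derivative (\<lambda>v. G (x, t) \<bullet> v)) (at x)"
    and \<phi>: "continuous_on {0..T} \<phi>"
  shows "((\<lambda>x. integral {0..T} (\<lambda>t. \<phi> t * F (x, t))) has_derivative
      (\<lambda>v. integral {0..T} (\<lambda>t. \<phi> t *\<^sub>R G (x, t)) \<bullet> v)) (at x)"
proof -
  have cG: "continuous_on {0..T} (\<lambda>t. \<phi> t *\<^sub>R G (x, t))" for x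
    by (intro continuous_intros \<phi> continuous_on_compose2[OF G]) auto
  have cF: "continuous_on {0..T} (\<lambda>t. \<phi> t * F (x, t))" for x
    by (intro continuous_intros \<phi> continuous_on_compose2[OF F]) auto
  have "((\<lambda>x. integral (cbox 0 T) (\<lambda>t. \<phi> t * F (x, t))) has_derivative
      integral (cbox 0 T) (\<lambda>t. blinfun_inner_left (\<phi> t *\<^sub>R G (x, t)))) (at x within UNIV)"
  proof (rule leibniz_rule)
    fix y t assume t: "t \<in> cbox 0 T"
    then have "((\<lambda>y. F (y, t)) has_derivative (\<lambda>v. G (y, t) \<bullet> v)) (at y)"
      by (intro has_derivative_boundary[OF F G D]) auto
    from has_derivative_mult_right[OF this, of "\<phi> t"]
    show "((\<lambda>x. \<phi> t * F (x, t)) has_derivative blinfun_apply (blinfun_inner_left (\<phi> t *\<^sub>R G (y, t))))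
        (at y within UNIV)"
      by (simp add: inner_commute)
  next
    show "(\<lambda>t. \<phi> t * F (y, t)) integrable_on cbox 0 T" for y
      using cF by (intro integrable_continuous) simp
    have "continuous_on (UNIV \<times> cbox 0 T) (\<lambda>p. \<phi> (snd p) *\<^sub>R G p)"
      by (intro continuous_intros continuous_on_compose2[OF \<phi>] continuous_on_subset[OF G]) auto
    from bounded_linear.continuous_on[OF bounded_linear_blinfun_inner_left this]
    show "continuous_on (UNIV \<times> cbox 0 T) (\<lambda>(x, t). blinfun_inner_left (\<phi> t *\<^sub>R G (x, t)))"
      by (simp add: split_beta)
  qed auto
  moreover have "integral (cbox 0 T) (\<lambda>t. blinfun_inner_left (\<phi> t *\<^sub>R G (x, t)))
      = blinfun_inner_left (integral (cbox 0 T) (\<lambda>t. \<phi> t *\<^sub>R G (x, t)))"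
    using integral_linear[OF integrable_continuous_interval[OF cG] bounded_linear_blinfun_inner_left, of x]
    by (simp add: o_def)
  ultimately show ?thesis by (simp add: inner_commute)
qed

lemma average_Ck_on_1:
  fixes F :: "(real^'n) \<times> real \<Rightarrow> real" and P :: "'n \<Rightarrow> (real^'n) \<times> real \<Rightarrow> real"
  assumes F: "continuous_on (UNIV \<times> {0..}) F" and P: "\<And>i. continuous_on (UNIV \<times> {0..}) (P i)"
    and D: "\<And>x t. t > 0 \<Longrightarrow> ((\<lambda>y. F (y, t)) has_derivative (\<lambda>v. (\<chi> i. P i (x, t)) \<bullet> v)) (at x)"
    and \<phi>: "continuous_on {0..T} \<phi>"
  defines "A \<equiv> \<lambda>x. integral {0..T} (\<lambda>t. \<phi> t * F (x, t))"
  shows "Ck_on 1 UNIV A"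
    and "partial (axis i 1) A = (\<lambda>x. integral {0..T} (\<lambda>t. \<phi> t * P i (x, t)))"
proof -
  have G: "continuous_on (UNIV \<times> {0..}) (\<lambda>p. \<chi> i. P i p)"
    by (intro continuous_on_vec_lambda P)
  have A: "(A has_derivative (\<lambda>v. integral {0..T} (\<lambda>t. \<phi> t *\<^sub>R (\<chi> i. P i (x, t))) \<bullet> v)) (at x)" for x
    unfolding A_def by (rule average_has_derivative[OF F G D \<phi>])
  have *: "partial (axis i 1) A = (\<lambda>x. integral {0..T} (\<lambda>t. \<phi> t * P i (x, t)))" for i
  proof
    fix x
    have "continuous_on {0..T} (\<lambda>t. \<phi> t *\<^sub>R (\<chi> i. P i (x, t)))"
      by (intro continuous_intros \<phi> continuous_on_compose2[OF G]) auto
    from integral_component_eq_cart[OF integrable_continuous_interval[OF this], of i]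
    show "partial (axis i 1) A x = integral {0..T} (\<lambda>t. \<phi> t * P i (x, t))"
      by (simp add: partial_eq[OF A] inner_axis)
  qed
  then show "partial (axis i 1) A = (\<lambda>x. integral {0..T} (\<lambda>t. \<phi> t * P i (x, t)))" .
  have "continuous_on UNIV (partial e A)" if e: "e \<in> Basis" for e
    using Basis_vec_cases[OF e] * average_continuous[OF P \<phi>] by metis
  then show "Ck_on 1 UNIV A"
    using differentiableI[OF A] by (simp add: Ck_on_1_iff del: Ck_on.simps One_nat_def)
qed

section \<open>Rigidity of solutions\<close>

text \<open>Here \<open>p i\<close>, \<open>q i j\<close>, \<open>un\<close> and \<open>unn\<close> are the tangential and normal derivatives of \<open>u\<close> of first
  and second order, extended continuously to the closed half-space. The derivatives
  themselves are available only in the open half-space, since \<open>u\<close> is arbitrary below the boundary.\<close>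

locale half_space_solution =
  fixes a :: "real^'n \<Rightarrow> real^'n^'n" and g :: "real^'n \<Rightarrow> real"
    and u :: "(real^'n) \<times> real \<Rightarrow> real"
    and p :: "'n \<Rightarrow> (real^'n) \<times> real \<Rightarrow> real" and q :: "'n \<Rightarrow> 'n \<Rightarrow> (real^'n) \<times> real \<Rightarrow> real"
    and un unn :: "(real^'n) \<times> real \<Rightarrow> real"
  assumes dim: "CARD('n) \<le> 2"
    and adm: "admissible_coeff a"
    and cont_u: "continuous_on (UNIV \<times> {0..}) u"
    and cont_p: "\<And>i. continuous_on (UNIV \<times> {0..}) (p i)"
    and cont_q: "\<And>i j. continuous_on (UNIV \<times> {0..}) (q i j)"
    and cont_un: "continuous_on (UNIV \<times> {0..}) un"
    and cont_unn: "continuous_on (UNIV \<times> {0..}) unn"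
    and deriv_u: "\<And>x t. t > 0 \<Longrightarrow> ((\<lambda>y. u (y, t)) has_derivative (\<lambda>v. (\<chi> i. p i (x, t)) \<bullet> v)) (at x)"
    and deriv_p: "\<And>j x t. t > 0 \<Longrightarrow>
          ((\<lambda>y. p j (y, t)) has_derivative (\<lambda>v. (\<chi> i. q i j (x, t)) \<bullet> v)) (at x)"
    and deriv_un: "\<And>x t. t > 0 \<Longrightarrow> ((\<lambda>s. u (x, s)) has_real_derivative un (x, t)) (at t)"
    and deriv_unn: "\<And>x t. t > 0 \<Longrightarrow> ((\<lambda>s. un (x, s)) has_real_derivative unn (x, t)) (at t)"
    and pde: "\<And>x t. t > 0 \<Longrightarrow>
          (\<Sum>i\<in>UNIV. \<Sum>j\<in>UNIV. partial (axis i 1) (\<lambda>x. a x $ i $ j) x * p j (x, t)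
             + a x $ i $ j * q i j (x, t)) + unn (x, t) = g x - u (x, t)"
    and bc: "\<And>x. u (x, 0) = 0"
    and nonneg: "\<And>x t. t \<ge> 0 \<Longrightarrow> 0 \<le> u (x, t)"
    and bdd: "\<exists>C. \<forall>x. \<forall>t\<in>{0..2 * pi}. u (x, t) \<le> C"
begin

abbreviation I :: "(real \<Rightarrow> real) \<Rightarrow> real" where
  "I \<equiv> integral {0..2 * pi}"

definition avg :: "(real \<Rightarrow> real) \<Rightarrow> real^'n \<Rightarrow> real" where
  "avg \<phi> x = I (\<lambda>t. \<phi> t * u (x, t))"

lemma slice:
  fixes f :: "(real^'n) \<times> real \<Rightarrow> real"
  assumes "continuous_on (UNIV \<times> {0..}) f"
  shows "continuous_on {0..2 * pi} (\<lambda>t. f (x, t))"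
  by (rule continuous_on_compose2[OF assms]) (auto intro!: continuous_intros)

lemma I_mult_slice:
  fixes f :: "(real^'n) \<times> real \<Rightarrow> real"
  assumes "continuous_on {0..2 * pi} \<phi>" and "continuous_on (UNIV \<times> {0..}) f"
  shows "(\<lambda>t. \<phi> t * f (x, t)) integrable_on {0..2 * pi}"
  by (intro integrable_continuous_interval continuous_on_mult assms(1) slice[OF assms(2)])

lemma avg_Ck_on_2:
  assumes \<phi>: "continuous_on {0..2 * pi} \<phi>"
  shows "Ck_on 2 UNIV (avg \<phi>)"
    and "partial (axis j 1) (avg \<phi>) = (\<lambda>x. I (\<lambda>t. \<phi> t * p j (x, t)))"
    and "partial (axis i 1) (partial (axis j 1) (avg \<phi>)) = (\<lambda>x. I (\<lambda>t. \<phi> t * q i j (x, t)))"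
proof -
  have avg: "avg \<phi> = (\<lambda>x. I (\<lambda>t. \<phi> t * u (x, t)))" by (simp add: avg_def fun_eq_iff)
  note 1 = average_Ck_on_1[OF cont_u cont_p deriv_u \<phi>, folded avg]
  note 2 = average_Ck_on_1[where F = "p k" and P = "\<lambda>i. q i k" for k, OF cont_p cont_q deriv_p \<phi>]
  show p: "partial (axis j 1) (avg \<phi>) = (\<lambda>x. I (\<lambda>t. \<phi> t * p j (x, t)))" for j by (rule 1(2))
  show "partial (axis i 1) (partial (axis j 1) (avg \<phi>)) = (\<lambda>x. I (\<lambda>t. \<phi> t * q i j (x, t)))"
    unfolding p by (rule 2(2))
  have "Ck_on 1 UNIV (partial e (avg \<phi>))" if "e \<in> Basis" for e
    using Basis_vec_cases[OF that] 2(1) p by metis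
  then show "Ck_on 2 UNIV (avg \<phi>)"
    using 1(1) by (simp add: numeral_2_eq_2)
qed

text \<open>Since the coefficients and \<open>g\<close> depend on the tangential variable only, averaging the equation
  against \<open>\<phi>\<close> gives an equation in the tangential variable; integrating by parts twice moves the
  normal derivatives onto \<open>\<phi>\<close>.\<close>

lemma elliptic_avg:
  assumes \<phi>: "\<And>t. (\<phi> has_real_derivative \<phi>' t) (at t)" and \<phi>': "\<And>t. (\<phi>' has_real_derivative \<phi>'' t) (at t)"
    and \<phi>'': "continuous_on UNIV \<phi>''"
  shows "elliptic a (avg \<phi>) x = g x * I \<phi> - I (\<lambda>t. (\<phi> t + \<phi>'' t) * u (x, t))
      - (\<phi> (2 * pi) * un (x, 2 * pi) - \<phi>' (2 * pi) * u (x, 2 * pi) - \<phi> 0 * un (x, 0))"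
proof -
  have c: "continuous_on {0..2 * pi} \<phi>" "continuous_on {0..2 * pi} \<phi>'" "continuous_on {0..2 * pi} \<phi>''"
    by (rule DERIV_continuous_on[OF has_field_derivative_at_within[OF \<phi>]],
        rule DERIV_continuous_on[OF has_field_derivative_at_within[OF \<phi>']],
        rule continuous_on_subset[OF \<phi>'']) simp
  let ?d = "\<lambda>i j. partial (axis i 1) (\<lambda>x. a x $ i $ j) x"
  let ?L = "\<lambda>t. \<Sum>i\<in>UNIV. \<Sum>j\<in>UNIV. ?d i j * p j (x, t) + a x $ i $ j * q i j (x, t)"
  have "((\<lambda>t. \<Sum>i\<in>UNIV. \<Sum>j\<in>UNIV. ?d i j * (\<phi> t * p j (x, t)) + a x $ i $ j * (\<phi> t * q i j (x, t)))
      has_integral elliptic a (avg \<phi>) x) {0..2 * pi}"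
    unfolding elliptic_expand[OF adm avg_Ck_on_2(1)[OF c(1)]] avg_Ck_on_2(3)[OF c(1)]
    unfolding avg_Ck_on_2(2)[OF c(1)]
    by (intro has_integral_sum finite has_integral_add has_integral_mult_right
        integrable_integral I_mult_slice c cont_p cont_q)
  then have 1: "((\<lambda>t. \<phi> t * ?L t) has_integral elliptic a (avg \<phi>) x) {0..2 * pi}"
    by (simp add: sum_distrib_left algebra_simps)
  have "((\<lambda>t. \<phi> t * unn (x, t) - \<phi>'' t * u (x, t)) has_integral
      (\<phi> (2 * pi) * un (x, 2 * pi) - \<phi>' (2 * pi) * u (x, 2 * pi)) - (\<phi> 0 * un (x, 0) - \<phi>' 0 * u (x, 0)))
      {0..2 * pi}"
  proof (rule fundamental_theorem_of_calculus_interior)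
    show "continuous_on {0..2 * pi} (\<lambda>t. \<phi> t * un (x, t) - \<phi>' t * u (x, t))"
      by (intro continuous_intros c slice cont_u cont_un)
    fix t :: real assume "t \<in> {0<..<2 * pi}"
    then have "t > 0" by simp
    have "((\<lambda>t. \<phi> t * un (x, t) - \<phi>' t * u (x, t)) has_real_derivative
        (\<phi>' t * un (x, t) + unn (x, t) * \<phi> t) - (\<phi>'' t * u (x, t) + un (x, t) * \<phi>' t)) (at t)"
      by (intro DERIV_diff DERIV_mult \<phi> \<phi>' deriv_un deriv_unn \<open>t > 0\<close>)
    then show "((\<lambda>t. \<phi> t * un (x, t) - \<phi>' t * u (x, t)) has_vector_derivative
        \<phi> t * unn (x, t) - \<phi>'' t * u (x, t)) (at t)"
      by (simp add: has_real_derivative_iff_has_vector_derivative[symmetric] algebra_simps)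
  qed simp
  moreover have "((\<lambda>t. g x * \<phi> t - (\<phi> t + \<phi>'' t) * u (x, t)) has_integral
      g x * I \<phi> - I (\<lambda>t. (\<phi> t + \<phi>'' t) * u (x, t))) {0..2 * pi}"
    by (intro has_integral_diff has_integral_mult_right integrable_integral I_mult_slice
        integrable_continuous_interval continuous_intros c cont_u)
  ultimately have "((\<lambda>t. (g x * \<phi> t - (\<phi> t + \<phi>'' t) * u (x, t)) - (\<phi> t * unn (x, t) - \<phi>'' t * u (x, t)))
      has_integral g x * I \<phi> - I (\<lambda>t. (\<phi> t + \<phi>'' t) * u (x, t))
      - ((\<phi> (2 * pi) * un (x, 2 * pi) - \<phi>' (2 * pi) * u (x, 2 * pi)) - (\<phi> 0 * un (x, 0) - \<phi>' 0 * u (x, 0))))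
      {0..2 * pi}"
    by (rule has_integral_diff[rotated])
  \<comment> \<open>The equation holds for \<open>t > 0\<close> only, so the end point \<open>0\<close> is discarded as a null set.\<close>
  then have "((\<lambda>t. \<phi> t * ?L t) has_integral g x * I \<phi> - I (\<lambda>t. (\<phi> t + \<phi>'' t) * u (x, t))
      - ((\<phi> (2 * pi) * un (x, 2 * pi) - \<phi>' (2 * pi) * u (x, 2 * pi)) - (\<phi> 0 * un (x, 0) - \<phi>' 0 * u (x, 0))))
      {0..2 * pi}"
  proof (rule has_integral_spike[of "{0}", rotated 2])
    fix t :: real assume "t \<in> {0..2 * pi} - {0}"
    then have eq: "?L t = g x - u (x, t) - unn (x, t)" using pde[of t x] by simp
    then show "\<phi> t * ?L t = g x * \<phi> t - (\<phi> t + \<phi>'' t) * u (x, t) - (\<phi> t * unn (x, t) - \<phi>'' t * u (x, t))"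
      unfolding eq by (simp add: algebra_simps)
  qed simp
  from has_integral_unique[OF 1 this] show ?thesis by (simp add: bc algebra_simps)
qed

lemma avg_bounded:
  assumes "continuous_on {0..2 * pi} \<phi>"
  obtains B where "\<And>x. \<bar>avg \<phi> x\<bar> \<le> B"
proof -
  obtain C where C: "\<And>x t. t \<in> {0..2 * pi} \<Longrightarrow> u (x, t) \<le> C" using bdd by blast
  have "norm (I (\<lambda>t. \<phi> t * u (x, t))) \<le> I (\<lambda>t. \<bar>\<phi> t\<bar> * C)" for x
  proof (rule integral_norm_bound_integral)
    show "(\<lambda>t. \<phi> t * u (x, t)) integrable_on {0..2 * pi}" by (rule I_mult_slice[OF assms cont_u])
    show "(\<lambda>t. \<bar>\<phi> t\<bar> * C) integrable_on {0..2 * pi}"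
      by (intro integrable_continuous_interval continuous_intros assms)
    show "norm (\<phi> t * u (x, t)) \<le> \<bar>\<phi> t\<bar> * C" if "t \<in> {0..2 * pi}" for t
      using C[OF that, of x] nonneg[of t x] that by (simp add: abs_mult mult_left_mono)
  qed
  then have "\<bar>avg \<phi> x\<bar> \<le> I (\<lambda>t. \<bar>\<phi> t\<bar> * C)" for x by (simp add: avg_def)
  then show thesis by (rule that)
qed

lemma constant_elliptic_zero:
  assumes "\<And>y. grad w y = 0" and "\<And>y. w differentiable at y"
  shows "w x = w z" and "elliptic a w x = 0"
proof -
  have "(w has_derivative (\<lambda>v. 0)) (at y)" for y
    using has_derivative_grad[OF assms(2)[of y]] assms(1)[of y] by simp
  then show "w x = w z"
    using has_derivative_zero_constant[of UNIV w] by auto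
  show "elliptic a w x = 0"
    by (simp add: elliptic_def assms(1) divergence_def partial_def)
qed

lemma avg_constant:
  assumes \<phi>: "continuous_on {0..2 * pi} \<phi>"
    and sub: "\<And>x. 0 \<le> (avg \<phi> x + c) * elliptic a (avg \<phi>) x"
  shows "avg \<phi> x = avg \<phi> z" and "elliptic a (avg \<phi>) x = 0"
proof -
  obtain B where B: "\<And>x. \<bar>avg \<phi> x\<bar> \<le> B" using avg_bounded[OF \<phi>] by blast
  have "\<bar>avg \<phi> x + c\<bar> \<le> B + \<bar>c\<bar>" for x
    using B[of x] by linarith
  then have "grad (avg \<phi>) y = 0" for y
    by (rule liouville[OF dim adm avg_Ck_on_2(1)[OF \<phi>] _ sub])
  moreover have "avg \<phi> differentiable at y" for y
    using avg_Ck_on_2(1)[OF \<phi>] by (simp add: numeral_2_eq_2)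
  ultimately show "avg \<phi> x = avg \<phi> z" "elliptic a (avg \<phi>) x = 0"
    using constant_elliptic_zero by blast+
qed

lemma avg_constant_if_elliptic_nonneg:
  assumes \<phi>: "continuous_on {0..2 * pi} \<phi>" and "\<And>x. 0 \<le> elliptic a (avg \<phi>) x"
  shows "elliptic a (avg \<phi>) x = 0"
proof -
  obtain B where B: "\<And>x. \<bar>avg \<phi> x\<bar> \<le> B" using avg_bounded[OF \<phi>] by blast
  have "0 \<le> avg \<phi> x + B" for x using B[of x] by linarith
  then show ?thesis using assms by (intro avg_constant(2)[of _ B] mult_nonneg_nonneg) auto
qed

text \<open>The weight \<open>sin\<close> solves \<open>\<phi>'' + \<phi> = 0\<close>, vanishes at both ends and has mean zero, so only the value at
  \<open>2\<pi>\<close> survives: the average is a bounded subsolution.\<close>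

lemma u_2pi: "u (x, 2 * pi) = 0"
proof -
  have "I sin = 0"
  proof -
    have "(sin has_integral (- cos (2 * pi) - (- cos 0))) {0..2 * pi}"
      by (rule fundamental_theorem_of_calculus)
        (auto intro!: derivative_eq_intros simp: has_real_derivative_iff_has_vector_derivative[symmetric])
    then show ?thesis by (simp add: integral_unique)
  qed
  then have L: "elliptic a (avg sin) x = u (x, 2 * pi)" for x
    using elliptic_avg[of sin cos "\<lambda>t. - sin t" x]
    by (simp add: DERIV_sin DERIV_cos continuous_intros)
  have "elliptic a (avg sin) x = 0"
    by (rule avg_constant_if_elliptic_nonneg) (auto simp: L nonneg intro!: continuous_intros)
  then show ?thesis by (simp add: L)
qed

text \<open>The value \<open>0\<close> at height \<open>2\<pi>\<close> is an interior minimum of \<open>t \<mapsto> u (x, t)\<close>.\<close>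

lemma un_2pi: "un (x, 2 * pi) = 0"
proof (rule DERIV_local_min)
  show "((\<lambda>s. u (x, s)) has_real_derivative un (x, 2 * pi)) (at (2 * pi))" by (rule deriv_un) simp
  show "0 < 2 * pi" by simp
  show "\<forall>y. \<bar>2 * pi - y\<bar> < 2 * pi \<longrightarrow> u (x, 2 * pi) \<le> u (x, y)"
    using nonneg by (auto simp: u_2pi abs_if split: if_splits)
qed

text \<open>Otherwise \<open>u\<close> would decrease from its boundary value \<open>0\<close> and become negative.\<close>

lemma un_0_nonneg: "un (x, 0) \<ge> 0"
proof (rule ccontr)
  assume neg: "\<not> un (x, 0) \<ge> 0"
  have "continuous_on {0..2 * pi} (\<lambda>t. un (x, t))" by (rule slice[OF cont_un])
  then have "\<exists>d>0. \<forall>t\<in>{0..2 * pi}. dist t 0 < d \<longrightarrow> dist (un (x, t)) (un (x, 0)) < - un (x, 0)"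
    using neg unfolding continuous_on_iff by (elim ballE[of _ _ 0]) auto
  then obtain d where d: "d > 0" "\<And>t. \<lbrakk>0 \<le> t; t \<le> 2 * pi; t < d\<rbrakk> \<Longrightarrow> un (x, t) < 0"
    by (force simp: dist_real_def abs_less_iff)
  define e where "e = min (d / 2) pi"
  have e: "0 < e" "e < d" "e \<le> 2 * pi" using d(1) pi_gt_zero by (auto simp: e_def min_def)
  have "\<exists>l z. 0 < z \<and> z < e \<and> ((\<lambda>t. u (x, t)) has_real_derivative l) (at z) \<and> u (x, e) - u (x, 0) = (e - 0) * l"
  proof (rule MVT[OF e(1)])
    show "continuous_on {0..e} (\<lambda>t. u (x, t))"
      using e(3) by (intro continuous_on_subset[OF slice[OF cont_u]]) auto
    show "(\<lambda>t. u (x, t)) differentiable (at z)" if "0 < z" "z < e" for z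
      using deriv_un[OF that(1), of x] unfolding real_differentiable_def by blast
  qed
  then obtain l z where z: "0 < z" "z < e" "((\<lambda>t. u (x, t)) has_real_derivative l) (at z)"
    "u (x, e) = e * l" by (auto simp: bc)
  have "l = un (x, z)" by (rule DERIV_unique[OF z(3) deriv_un[OF z(1)]])
  then have "l < 0" using d(2)[of z] z e by simp
  then have "u (x, e) < 0" using z(4) e(1) by (simp add: mult_pos_neg)
  then show False using nonneg[of e x] e(1) by simp
qed

text \<open>The cosines have mean zero and derivative zero at both ends, and at height \<open>2\<pi>\<close> the normal
  derivative is already known to vanish.\<close>

lemma elliptic_avg_cos:
  assumes "k \<ge> 1"
  shows "elliptic a (avg (\<lambda>t. cos (real k * t / 2))) x
      = ((real k / 2)\<^sup>2 - 1) * avg (\<lambda>t. cos (real k * t / 2)) x + un (x, 0)"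
proof -
  let ?c = "\<lambda>t. cos (real k * t / 2)" and ?c' = "\<lambda>t. - (real k / 2) * sin (real k * t / 2)"
    and ?c'' = "\<lambda>t. - (real k / 2)\<^sup>2 * cos (real k * t / 2)"
  have "elliptic a (avg ?c) x = g x * I ?c - I (\<lambda>t. (?c t + ?c'' t) * u (x, t))
      - (?c (2 * pi) * un (x, 2 * pi) - ?c' (2 * pi) * u (x, 2 * pi) - ?c 0 * un (x, 0))"
  proof (rule elliptic_avg)
    show "(?c has_real_derivative ?c' t) (at t)" for t by (auto intro!: derivative_eq_intros)
    show "(?c' has_real_derivative ?c'' t) (at t)" for t
      by (auto intro!: derivative_eq_intros simp: power2_eq_square)
    show "continuous_on UNIV ?c''" by (intro continuous_intros) auto
  qed
  also have "I (\<lambda>t. (?c t + ?c'' t) * u (x, t)) = I (\<lambda>t. (1 - (real k / 2)\<^sup>2) * (?c t * u (x, t)))"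
    by (simp add: algebra_simps)
  also have "\<dots> = (1 - (real k / 2)\<^sup>2) * avg ?c x" by (simp only: integral_mult_right avg_def)
  also have "I ?c = 0" by (rule integral_cos_half[OF assms])
  finally show ?thesis unfolding u_2pi un_2pi by (simp add: left_diff_distrib)
qed

text \<open>For \<open>k = 2\<close>, that is for the weight \<open>cos\<close>, the zeroth-order term drops out and the average is a bounded
  subsolution.\<close>

lemma un_0: "un (x, 0) = 0"
proof -
  have L: "elliptic a (avg (\<lambda>t. cos (real 2 * t / 2))) x = un (x, 0)" for x
    using elliptic_avg_cos[of 2 x] by simp
  have "elliptic a (avg (\<lambda>t. cos (real 2 * t / 2))) x = 0"
  proof (rule avg_constant_if_elliptic_nonneg)
    show "continuous_on {0..2 * pi} (\<lambda>t. cos (real 2 * t / 2))" by (intro continuous_intros) auto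
  qed (simp only: L un_0_nonneg)
  then show ?thesis by (simp only: L)
qed

text \<open>With vanishing Cauchy data at both ends, every cosine average solves \<open>div (a \<nabla>w) = \<mu> w\<close> with
  \<open>\<mu> = k\<^sup>2/4 - 1 \<ge> 0\<close> for \<open>k \<ge> 2\<close>, hence is constant.\<close>

lemma u_independent:
  assumes "t \<in> {0..2 * pi}"
  shows "u (x, t) = u (z, t)"
proof -
  have "avg (\<lambda>t. cos (real k * t / 2)) x = avg (\<lambda>t. cos (real k * t / 2)) z" if "k \<ge> 2" for k
  proof (rule avg_constant(1)[of _ 0])
    show "continuous_on {0..2 * pi} (\<lambda>t. cos (real k * t / 2))" by (intro continuous_intros) auto
    have "1\<^sup>2 \<le> (real k / 2)\<^sup>2" using that by (intro power_mono) auto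
    then show "0 \<le> (avg (\<lambda>t. cos (real k * t / 2)) x + 0) * elliptic a (avg (\<lambda>t. cos (real k * t / 2))) x" for x
      using that by (simp add: elliptic_avg_cos un_0 mult.left_commute)
  qed
  moreover have "I (\<lambda>t. (u (x, t) - u (z, t)) * cos (real k * t / 2))
      = avg (\<lambda>t. cos (real k * t / 2)) x - avg (\<lambda>t. cos (real k * t / 2)) z" for k
  proof -
    have "continuous_on {0..2 * pi} (\<lambda>t. cos (real k * t / 2))" by (intro continuous_intros) auto
    from I_mult_slice[OF this cont_u]
    have "I (\<lambda>t. cos (real k * t / 2) * u (x, t) - cos (real k * t / 2) * u (z, t))
        = avg (\<lambda>t. cos (real k * t / 2)) x - avg (\<lambda>t. cos (real k * t / 2)) z"
      unfolding avg_def by (intro Henstock_Kurzweil_Integration.integral_diff)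
    then show ?thesis by (simp only: left_diff_distrib mult.commute[of "u _"])
  qed
  ultimately have coeff: "I (\<lambda>t. (u (x, t) - u (z, t)) * cos (real k * t / 2)) = 0" if "k \<ge> 2" for k
    using that by simp
  have "continuous_on {0..2 * pi} (\<lambda>t. u (x, t) - u (z, t))"
    by (intro continuous_on_diff slice cont_u)
  from zero_if_higher_cosine_coefficients_zero[OF this coeff _ _ assms]
  show ?thesis by (simp add: bc u_2pi)
qed

text \<open>With the weight \<open>1\<close> the averaged equation expresses \<open>g\<close> through \<open>u\<close>.\<close>

theorem g_constant: "g x = g z"
proof -
  have avg: "avg (\<lambda>_. 1) y = avg (\<lambda>_. 1) z" for y
    unfolding avg_def using u_independent[of _ y z] by (intro integral_cong) auto
  have "grad (\<lambda>_. avg (\<lambda>_. 1) z) y = 0" for y by (rule grad_eq) simp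
  moreover have "avg (\<lambda>_. 1) = (\<lambda>_. avg (\<lambda>_. 1) z)" using avg by blast
  ultimately have "grad (avg (\<lambda>_. 1)) y = 0" for y by metis
  then have "elliptic a (avg (\<lambda>_. 1)) y = 0" for y
    by (simp add: elliptic_def divergence_def partial_def)
  moreover have "elliptic a (avg (\<lambda>_. 1)) y = g y * (2 * pi) - avg (\<lambda>_. 1) y" for y
    using elliptic_avg[of "\<lambda>_. 1" "\<lambda>_. 0" "\<lambda>_. 0" y]
    by (simp add: un_2pi un_0 avg_def)
  ultimately have "g x * (2 * pi) = g z * (2 * pi)" using avg[of x] by (metis eq_iff_diff_eq_0)
  then show ?thesis by simp
qed

end

section \<open>From the half-space problem to the averaged setting\<close>

lemma closure_halfspace: "closure (halfspace :: ((real^'n) \<times> real) set) = UNIV \<times> {0..}"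
  by (simp add: halfspace_def closure_Times)

lemma frontier_halfspace: "frontier (halfspace :: ((real^'n) \<times> real) set) = UNIV \<times> {0}"
proof -
  have "open (halfspace :: ((real^'n) \<times> real) set)"
    unfolding halfspace_def by (intro open_Times) auto
  then show ?thesis
    unfolding frontier_def closure_halfspace by (auto simp: interior_open halfspace_def)
qed

lemma extends_to_closure_halfspace:
  fixes f :: "(real^'n) \<times> real \<Rightarrow> real"
  assumes "extends_to_closure halfspace f"
  shows "\<exists>h. continuous_on (UNIV \<times> {0..}) h \<and> (\<forall>x t. t > 0 \<longrightarrow> h (x, t) = f (x, t))"
  using assms by (simp add: extends_to_closure_def closure_halfspace) (auto simp: halfspace_def)

lemma sum_Basis_vec_prod:
  fixes f :: "(real^'n) \<times> real \<Rightarrow> real"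
  shows "(\<Sum>e\<in>Basis. f e) = (\<Sum>i\<in>UNIV. f (axis i 1, 0)) + f (0, 1)"
proof -
  have "(\<Sum>e\<in>Basis. f e) = (\<Sum>e\<in>(\<lambda>v. (v, 0)) ` Basis. f e) + (\<Sum>e\<in>(\<lambda>s. (0, s)) ` Basis. f e)"
    unfolding Basis_prod_def by (rule sum.union_disjoint) auto
  also have "(\<Sum>e\<in>(\<lambda>v. (v, 0)) ` Basis. f e) = (\<Sum>v\<in>Basis. f (v, 0))"
    by (subst sum.reindex) (auto simp: inj_on_def)
  finally show ?thesis by (simp add: sum_Basis_vec)
qed

lemma divergence_block_mult:
  fixes a :: "real^'n \<Rightarrow> real^'n^'n" and u :: "(real^'n) \<times> real \<Rightarrow> real"
  assumes adm: "admissible_coeff a"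
    and u: "\<And>e. e \<in> Basis \<Longrightarrow> partial e u differentiable at (x, t)"
  shows "divergence (\<lambda>y. block_mult (a (fst y)) (grad u y)) (x, t)
    = (\<Sum>i\<in>UNIV. \<Sum>j\<in>UNIV. partial (axis i 1) (\<lambda>x. a x $ i $ j) x * partial (axis j 1, 0) u (x, t)
        + a x $ i $ j * partial (axis i 1, 0) (partial (axis j 1, 0) u) (x, t))
      + partial (0, 1) (partial (0, 1) u) (x, t)"
proof -
  have a: "((\<lambda>y. a (fst y) $ i $ j) has_derivative (\<lambda>v. grad (\<lambda>x. a x $ i $ j) x \<bullet> fst v)) (at (x, t))" for i j
  proof (rule has_derivative_compose[of fst])
    show "(fst has_derivative fst) (at (x, t))" by (auto intro!: derivative_eq_intros)
    have "(\<lambda>x. a x $ i $ j) differentiable at x"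
      using adm by (simp add: admissible_coeff_def)
    then show "((\<lambda>x. a x $ i $ j) has_derivative (\<lambda>v. grad (\<lambda>x. a x $ i $ j) x \<bullet> v)) (at (fst (x, t)))"
      using has_derivative_grad by simp
  qed
  have da: "(\<lambda>y. a (fst y) $ i $ j) differentiable at (x, t)" for i j by (rule differentiableI[OF a])
  have pa: "partial (axis k 1, 0) (\<lambda>y. a (fst y) $ i $ j) (x, t) = partial (axis k 1) (\<lambda>x. a x $ i $ j) x" for i j k
    by (simp add: partial_eq[OF a] inner_axis grad_nth)
  have du: "partial (axis j 1, 0) u differentiable at (x, t)" for j
    by (rule u) (simp add: Basis_prod_def axis_in_Basis_iff)
  have comp: "block_mult (a (fst y)) (grad u y) \<bullet> (axis i 1, 0)
      = (\<Sum>j\<in>UNIV. a (fst y) $ i $ j * partial (axis j 1, 0) u y)"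
    "block_mult (a (fst y)) (grad u y) \<bullet> (0, 1) = partial (0, 1) u y" for y i
    by (simp_all add: block_mult_def inner_prod_def inner_axis matrix_vector_mult_def grad_prod)
  show ?thesis
    unfolding divergence_def sum_Basis_vec_prod
    by (simp add: comp partial_sum differentiable_mult da du partial_mult pa add.commute)
qed

text \<open>Regularity up to the boundary supplies the continuous extensions of the derivatives; in the open
  half-space they agree with the derivatives, so the equation carries over.\<close>

lemma half_space_solution_exists:
  fixes a :: "real^'n \<Rightarrow> real^'n^'n" and g :: "real^'n \<Rightarrow> real"
  assumes dim: "CARD('n) \<le> 2" and adm: "admissible_coeff a"
    and C2: "Ck_closure 2 halfspace u" and P: "solves_P a g u" and B: "condition_B u"
  obtains p q un unn where "half_space_solution a g u p q un unn"
proof -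
  let ?e = "\<lambda>i. (axis i 1, 0) :: (real^'n) \<times> real" and ?n = "(0, 1) :: (real^'n) \<times> real"
  have basis: "?e i \<in> Basis" "?n \<in> Basis" for i
    by (simp_all add: Basis_prod_def axis_in_Basis_iff)
  have d1: "u differentiable at (x, t)" if "t > 0" for x t
    using C2 that by (simp add: Ck_closure_def numeral_2_eq_2 halfspace_def)
  have d2: "partial e u differentiable at (x, t)" if "t > 0" "e \<in> Basis" for x t e
    using C2 that by (simp add: Ck_closure_def numeral_2_eq_2 halfspace_def)
  have ext1: "extends_to_closure halfspace (partial e u)" if "e \<in> Basis" for e
    using C2 that by (simp add: Ck_closure_def numeral_2_eq_2)
  have ext2: "extends_to_closure halfspace (partial d (partial e u))" if "d \<in> Basis" "e \<in> Basis" for d e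
    using C2 that by (simp add: Ck_closure_def numeral_2_eq_2)
  obtain p where p: "\<And>i. continuous_on (UNIV \<times> {0..}) (p i)"
    "\<And>i x t. t > 0 \<Longrightarrow> p i (x, t) = partial (?e i) u (x, t)"
    using extends_to_closure_halfspace[OF ext1[OF basis(1)]] by metis
  obtain q where q: "\<And>i j. continuous_on (UNIV \<times> {0..}) (q i j)"
    "\<And>i j x t. t > 0 \<Longrightarrow> q i j (x, t) = partial (?e i) (partial (?e j) u) (x, t)"
    using extends_to_closure_halfspace[OF ext2[OF basis(1) basis(1)]] by metis
  obtain un where un: "continuous_on (UNIV \<times> {0..}) un"
    "\<And>x t. t > 0 \<Longrightarrow> un (x, t) = partial ?n u (x, t)"
    using extends_to_closure_halfspace[OF ext1[OF basis(2)]] by metis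
  obtain unn where unn: "continuous_on (UNIV \<times> {0..}) unn"
    "\<And>x t. t > 0 \<Longrightarrow> unn (x, t) = partial ?n (partial ?n u) (x, t)"
    using extends_to_closure_halfspace[OF ext2[OF basis(2) basis(2)]] by metis
  have "half_space_solution a g u p q un unn"
  proof
    show "CARD('n) \<le> 2" "admissible_coeff a" by (fact dim adm)+
    show "continuous_on (UNIV \<times> {0..}) u"
      using C2 by (simp add: Ck_closure_def closure_halfspace)
    show "continuous_on (UNIV \<times> {0..}) (p i)" "continuous_on (UNIV \<times> {0..}) (q i j)"
      "continuous_on (UNIV \<times> {0..}) un" "continuous_on (UNIV \<times> {0..}) unn" for i j
      by (fact p q un unn)+
    show "((\<lambda>y. u (y, t)) has_derivative (\<lambda>v. (\<chi> i. p i (x, t)) \<bullet> v)) (at x)" if "t > 0" for x t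
      using has_derivative_tangential[OF d1[OF that]] by (simp add: p(2)[OF that])
    show "((\<lambda>y. p j (y, t)) has_derivative (\<lambda>v. (\<chi> i. q i j (x, t)) \<bullet> v)) (at x)" if "t > 0" for j x t
      using has_derivative_tangential[OF d2[OF that basis(1)[of j]]] by (simp add: p(2)[OF that] q(2)[OF that])
    show "((\<lambda>s. u (x, s)) has_real_derivative un (x, t)) (at t)" if "t > 0" for x t
      using has_derivative_normal[OF d1[OF that]] by (simp add: un(2)[OF that])
    show "((\<lambda>s. un (x, s)) has_real_derivative unn (x, t)) (at t)" if "t > 0" for x t
    proof -
      have "((\<lambda>s. partial ?n u (x, s)) has_real_derivative unn (x, t)) (at t)"
        using has_derivative_normal[OF d2[OF that basis(2)]] by (simp add: unn(2)[OF that])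
      then show ?thesis
        by (rule has_field_derivative_transform_within_open[of _ _ _ "{0<..}"]) (use that un(2) in auto)
    qed
    show "(\<Sum>i\<in>UNIV. \<Sum>j\<in>UNIV. partial (axis i 1) (\<lambda>x. a x $ i $ j) x * p j (x, t)
             + a x $ i $ j * q i j (x, t)) + unn (x, t) = g x - u (x, t)" if "t > 0" for x t
    proof -
      have "- divergence (\<lambda>y. block_mult (a (fst y)) (grad u y)) (x, t) = u (x, t) - g x"
        using P that by (simp add: solves_P_def halfspace_def)
      then show ?thesis
        using divergence_block_mult[OF adm d2[OF that], of x] by (simp add: p(2) q(2) unn(2) that)
    qed
    show "u (x, 0) = 0" for x
      using P by (simp add: solves_P_def frontier_halfspace)
    show "0 \<le> u (x, t)" if "t \<ge> 0" for x t
    proof -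
      have "t + 1 > 0" using that by simp
      then obtain C where "\<forall>x\<in>UNIV \<times> {0..t + 1}. 0 \<le> u x \<and> u x \<le> C"
        using B unfolding condition_B_def by blast
      then show ?thesis using that by auto
    qed
    have "2 * pi > 0" by simp
    then obtain C where "\<forall>x\<in>UNIV \<times> {0..2 * pi}. 0 \<le> u x \<and> u x \<le> C"
      using B unfolding condition_B_def by blast
    then show "\<exists>C. \<forall>x. \<forall>t\<in>{0..2 * pi}. u (x, t) \<le> C" by auto
  qed
  then show thesis by (rule that)
qed

theorem theorem4p3:
  fixes a :: "real^'n \<Rightarrow> real^'n^'n" and g :: "real^'n \<Rightarrow> real"
  assumes "DIM((real^'n) \<times> real) = 2 \<or> DIM((real^'n) \<times> real) = 3"
    and "admissible_coeff a"
    and "continuous_on UNIV g"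
  shows "(\<not> g constant_on UNIV \<longrightarrow>
            \<not> (\<exists>u. Ck_closure 2 halfspace u \<and> solves_P a g u \<and> condition_B u))
       \<and> ((\<exists>u. Ck_closure 2 halfspace u \<and> solves_P a g u \<and> condition_B u) \<longrightarrow>
            g constant_on UNIV)"
proof -
  have dim: "CARD('n) \<le> 2" using assms(1) by auto
  have "g constant_on UNIV"
    if u: "Ck_closure 2 halfspace u" "solves_P a g u" "condition_B u" for u
  proof -
    obtain p q un unn where "half_space_solution a g u p q un unn"
      using half_space_solution_exists[OF dim assms(2) u] .
    then have "g x = g 0" for x by (rule half_space_solution.g_constant)
    then show ?thesis unfolding constant_on_def by blast
  qed
  then show ?thesis by blast
qed

end
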